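(* We have \[\lim_{x\to\infty}\frac{\mathcal{P}_{\mathcal{A}}(x)}{\mathcal{P}_{\mathcal{C}}(x)}=\infty.\] In fact, for every $\epsilon>0$ and all sufficiently large $x$ (depending on $\epsilon$), \[\frac{\mathcal{P}_{\mathcal{A}}(x)}{\mathcal{P}_{\mathcal{C}}(x)}>\exp\left(\left(\frac{1}{2\sqrt{\log 2}}-\epsilon\right)\sqrt{\log x}\,\log\log x\right).\]
   Context: A covering system is a finite set of pairs $(a_i,m_i)$ such that every integer satisfies at least one of the congruences $x\equiv a_i \pmod{m_i}$. It is distinct if each modulus is used at most once. A positive integer $n$ is a covering number if there exists a distinct covering system in which every modulus is a divisor of $n$ that is greater than $1$. A covering number $n$ is a primitive covering number if it is not divisible by any smaller covering number. $\mathcal{P}_{\mathcal{C}}(x)$ denotes the number of primitive covering numbers $n\le x$. Let $\sigma(n)=\sum_{d\mid n}d$. A positive integer $n$ is called primitive abundant (also called primitive non-deficient) if $\sigma(n)\ge 2n$ but no proper divisor $d$ of $n$ satisfies $\sigma(d)\ge 2d$. $\mathcal{P}_{\mathcal{A}}(x)$ denotes the number of primitive abundant numbers $n\le x$. *)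

theory Defs
  imports Complex_Main "HOL-Number_Theory.Cong"
begin

definition covering_system :: "(int \<times> nat) set \<Rightarrow> bool" where
  "covering_system C \<longleftrightarrow>
     finite C \<and> (\<forall>(a, m) \<in> C. m > 0) \<and> (\<forall>x::int. \<exists>(a, m) \<in> C. [x = a] (mod int m))"

definition distinct_covering_system :: "(int \<times> nat) set \<Rightarrow> bool" where
  "distinct_covering_system C \<longleftrightarrow> covering_system C \<and> inj_on snd C"

definition covering_number :: "nat \<Rightarrow> bool" where
  "covering_number n \<longleftrightarrow>
     n > 0 \<and> (\<exists>C. distinct_covering_system C \<and> (\<forall>(a, m) \<in> C. m dvd n \<and> m > 1))"

definition primitive_covering_number :: "nat \<Rightarrow> bool" where
  "primitive_covering_number n \<longleftrightarrow>
     covering_number n \<and> (\<forall>d. d < n \<longrightarrow> covering_number d \<longrightarrow> \<not> d dvd n)"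

text \<open>For \<open>n = 0\<close> the index set is infinite, so the value is the junk value \<open>0\<close>;
  the function is used below only for positive arguments.\<close>

definition divisor_sum :: "nat \<Rightarrow> nat" where
  "divisor_sum n = (\<Sum>d | d dvd n. d)"

text \<open>``Abundant'' is taken in the non-strict sense (non-deficient), so perfect numbers
  such as \<open>6\<close> count as primitive abundant.\<close>

definition primitive_abundant :: "nat \<Rightarrow> bool" where
  "primitive_abundant n \<longleftrightarrow>
     n > 0 \<and> divisor_sum n \<ge> 2 * n \<and>
     (\<forall>d. d dvd n \<longrightarrow> d \<noteq> n \<longrightarrow> \<not> divisor_sum d \<ge> 2 * d)"

definition primitive_covering_count :: "real \<Rightarrow> nat" where
  "primitive_covering_count x = card {n. primitive_covering_number n \<and> real n \<le> x}"

definition primitive_abundant_count :: "real \<Rightarrow> nat" where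
  "primitive_abundant_count x = card {n. primitive_abundant n \<and> real n \<le> x}"

end

theory Submission
  imports Defs "HOL-Computational_Algebra.Squarefree" "HOL-Real_Asymp.Real_Asymp"
begin

text \<open>
  Write \<open>L = ln x\<close>. Primitive covering numbers are rarer than \<open>x\<close> by a factor
  \<open>exp ((1 / (2 * sqrt (ln 2)) - o(1)) * sqrt L * ln L)\<close>, whereas primitive abundant numbers are
  rarer than \<open>x\<close> only by a factor \<open>exp (o(sqrt L * ln L))\<close>; the quotient of the two bounds is the
  claim.

  Upper bound for covering numbers. Let \<open>\<tau>\<close> count divisors. If \<open>p\<close> is a prime factor of a
  primitive covering number \<open>n\<close>, then some class modulo \<open>n / p\<close> is left uncovered by the moduli
  dividing \<open>n / p\<close>; it splits into \<open>p\<close> classes modulo \<open>n\<close>, and every other modulus takes care of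
  at most one of them. Hence \<open>p \<le> \<tau>(n)\<close>. Write \<open>n = c * d\<^sup>2\<close> with \<open>c\<close> squarefree. With
  \<open>\<tau>(n) = 2 powr t\<close>, the number \<open>c\<close> has at most \<open>t\<close> prime factors, each at most \<open>2 powr t\<close>, so
  \<open>n \<le> 2 powr t\<^sup>2 * d\<^sup>2\<close>. A large square factor \<open>d\<^sup>2\<close> is rare, and without one \<open>t\<close> is at least
  about \<open>sqrt (L / ln 2)\<close>. So many divisors are rare as well: submultiplicativity of \<open>\<tau>\<close> gives
  \<open>(\<Sum>n\<le>x. \<tau>(n) ^ s) \<le> x * (1 + L) ^ 2 ^ s\<close>, and Markov's inequality with \<open>2 ^ s\<close> slightly below
  \<open>sqrt L\<close> yields the exponent \<open>1 / (2 * sqrt (ln 2))\<close>. The steps are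
  \<open>prime_divisor_le_num_divisors\<close>, \<open>primitive_covering_ln_le\<close>, \<open>num_divisors_moment_le\<close> and
  \<open>primitive_covering_count_asymp\<close>.

  Lower bound for abundant numbers. Consider numbers \<open>N = 2 ^ l * \<Prod>S\<close> with \<open>S\<close> a set of \<open>k\<close>
  primes of size about \<open>2 ^ j\<close>, where \<open>\<sigma>(N) / N\<close> exceeds \<open>2\<close> by a factor of at most
  \<open>exp (O(2 ^ -j))\<close>. Each has a primitive abundant divisor \<open>n\<close>. Omitting a prime of size \<open>2 ^ j\<close>
  costs a factor \<open>1 + 2 ^ -j\<close> of \<open>\<sigma>(N) / N\<close>, so \<open>n\<close> omits only boundedly many elements of \<open>S\<close>,
  and \<open>N / n \<le> 2 ^ O(j)\<close>. As \<open>S\<close> is determined by \<open>n\<close> and \<open>N / n\<close>, there are at least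
  \<open>2 ^ -O(j)\<close> times as many primitive abundant numbers as sets \<open>S\<close>. To hit the narrow range of
  \<open>\<sigma>(N) / N\<close>, the primes are taken from two short windows at different scales, each rich in primes
  by Chebyshev's bounds and the pigeonhole principle; the number taken from each window balances
  \<open>\<sigma>(N) / N\<close>. With \<open>k\<close> a small multiple of \<open>sqrt L\<close> and \<open>j * k\<close> about \<open>L / ln 2\<close>, the losses are
  powers of \<open>L\<close> for each of the \<open>k\<close> primes. The steps are \<open>prime_window_exists\<close>,
  \<open>nondeficient_divisor_cofactor_le\<close>, \<open>primitive_abundant_count_ge\<close> and
  \<open>primitive_abundant_count_asymp\<close>.
\<close>

section \<open>Primitive covering numbers have small prime factors\<close>

text \<open>
  The classical system of Erdos; it makes the count of primitive covering numbers eventually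
  positive, without which the quotient of the two counts would take the default value \<open>0\<close>.
\<close>

lemma covering_number_12: "covering_number 12"
proof -
  define C :: "(int \<times> nat) set" where "C = {(0, 2), (0, 3), (1, 4), (5, 6), (7, 12)}"
  have "\<exists>(a, m)\<in>C. [x = a] (mod int m)" for x :: int
  proof -
    define r where "r = x mod 12"
    have red: "x mod 2 = r mod 2" "x mod 3 = r mod 3" "x mod 4 = r mod 4" "x mod 6 = r mod 6"
      by (simp_all add: r_def mod_mod_cancel)
    have "0 \<le> r" "r < 12" by (simp_all add: r_def)
    hence "r = 0 \<or> r = 1 \<or> r = 2 \<or> r = 3 \<or> r = 4 \<or> r = 5 \<or> r = 6 \<or> r = 7 \<or> r = 8 \<or> r = 9
        \<or> r = 10 \<or> r = 11" by (smt (verit))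
    hence "x mod 2 = 0 \<or> x mod 3 = 0 \<or> x mod 4 = 1 \<or> x mod 6 = 5 \<or> x mod 12 = 7"
      unfolding red r_def[symmetric] by (elim disjE) simp_all
    thus ?thesis by (simp add: C_def unique_euclidean_semiring_class.cong_def)
  qed
  hence "distinct_covering_system C"
    by (auto simp: distinct_covering_system_def covering_system_def C_def)
  moreover have "\<forall>(a, m)\<in>C. m dvd 12 \<and> m > 1" by (auto simp: C_def)
  ultimately show ?thesis by (auto simp: covering_number_def)
qed

lemma primitive_covering_count_pos:
  assumes "x \<ge> 12"
  shows "primitive_covering_count x > 0"
proof -
  define n where "n = (LEAST n. covering_number n)"
  have "covering_number n" unfolding n_def using covering_number_12 by (rule LeastI)
  moreover have "\<not> covering_number d" if "d < n" for d using that not_less_Least unfolding n_def by blast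
  ultimately have "primitive_covering_number n" by (auto simp: primitive_covering_number_def)
  moreover have "n \<le> 12" unfolding n_def using covering_number_12 by (rule Least_le)
  hence "real n \<le> x" using assms by linarith
  moreover have "finite {n. primitive_covering_number n \<and> real n \<le> x}"
    by (rule finite_subset[of _ "{..nat \<lfloor>x\<rfloor>}"]) (auto simp: le_nat_iff le_floor_iff)
  ultimately show ?thesis unfolding primitive_covering_count_def by (subst card_gt_0_iff) blast
qed

definition num_divisors :: "nat \<Rightarrow> nat" where
  "num_divisors n = card {d. d dvd n}"

lemma num_divisors_pos: "n > 0 \<Longrightarrow> num_divisors n > 0"
  unfolding num_divisors_def by (subst card_gt_0_iff) auto

text \<open>
  By minimality \<open>n' = n / p\<close> is not a covering number, so the moduli dividing \<open>n'\<close> miss some \<open>x\<close>,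
  hence they miss all of \<open>x, x + n', \<dots>, x + (p - 1) * n'\<close>. The moduli that cover these \<open>p\<close>
  numbers are pairwise distinct divisors of \<open>n\<close>: a modulus \<open>m\<close> serving two of them would divide both
  \<open>n' * p\<close> and \<open>n' * (i - j)\<close> with \<open>i - j\<close> prime to \<open>p\<close>, and so would divide \<open>n'\<close>.
\<close>

lemma prime_divisor_le_num_divisors:
  assumes prim: "primitive_covering_number n" and p: "prime p" "p dvd n"
  shows "p \<le> num_divisors n"
proof -
  obtain n' where n': "n = p * n'" using p(2) by (elim dvdE)
  from prim have cov: "covering_number n"
    and minimal: "\<And>d. d < n \<Longrightarrow> covering_number d \<Longrightarrow> \<not> d dvd n"
    by (auto simp: primitive_covering_number_def)
  have "n > 0" using cov by (simp add: covering_number_def)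
  have p2: "p \<ge> 2" using p(1) by (rule prime_ge_2_nat)
  have "n' > 0" using \<open>n > 0\<close> n' by (cases n') auto
  hence "n' < n" using p2 n' by simp
  hence not_cov: "\<not> covering_number n'" using minimal[of n'] n' by auto
  obtain C where C: "distinct_covering_system C" and Cdiv: "\<forall>(a, m) \<in> C. m dvd n \<and> m > 1"
    using cov by (auto simp: covering_number_def)
  have Cfin: "finite C" and Cinj: "inj_on snd C" and Cpos: "\<forall>(a, m) \<in> C. m > 0"
    and Ccov: "\<And>x::int. \<exists>(a, m) \<in> C. [x = a] (mod int m)"
    using C by (auto simp: distinct_covering_system_def covering_system_def)
  define C' where "C' = {c \<in> C. snd c dvd n'}"
  have "\<not> covering_system C'"
  proof
    assume "covering_system C'"
    moreover have "inj_on snd C'" using Cinj by (rule inj_on_subset) (auto simp: C'_def)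
    ultimately have "distinct_covering_system C'" by (simp add: distinct_covering_system_def)
    moreover have "\<forall>(a, m) \<in> C'. m dvd n' \<and> m > 1" using Cdiv by (auto simp: C'_def)
    ultimately have "covering_number n'" using \<open>n' > 0\<close> by (auto simp: covering_number_def)
    with not_cov show False by simp
  qed
  moreover have "finite C'" "\<forall>(a, m) \<in> C'. m > 0" using Cfin Cpos by (auto simp: C'_def)
  ultimately obtain x :: int where x: "\<And>a m. (a, m) \<in> C' \<Longrightarrow> \<not> [x = a] (mod int m)"
    unfolding covering_system_def by blast
  have "\<exists>m. \<exists>a. (a, m) \<in> C \<and> [x + int n' * int j = a] (mod int m)" for j
    using Ccov[of "x + int n' * int j"] by auto
  then obtain M where M: "\<And>j. \<exists>a. (a, M j) \<in> C \<and> [x + int n' * int j = a] (mod int (M j))"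
    by metis
  have M_not_dvd: "\<not> M j dvd n'" for j
  proof
    assume dvd: "M j dvd n'"
    obtain a where a: "(a, M j) \<in> C" "[x + int n' * int j = a] (mod int (M j))" using M by blast
    have "[x = x + int n' * int j] (mod int (M j))" using dvd by (simp add: cong_iff_dvd_diff)
    hence "[x = a] (mod int (M j))" using a(2) by (rule cong_trans)
    moreover have "(a, M j) \<in> C'" using a(1) dvd by (simp add: C'_def)
    ultimately show False using x by blast
  qed
  have "inj_on M {..<p}"
  proof (rule inj_onI, rule ccontr)
    fix i j assume ij: "i \<in> {..<p}" "j \<in> {..<p}" "M i = M j" "i \<noteq> j"
    obtain a where a: "(a, M i) \<in> C" "[x + int n' * int i = a] (mod int (M i))" using M by blast
    obtain b where b: "(b, M j) \<in> C" "[x + int n' * int j = b] (mod int (M j))" using M by blast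
    have "(a, M i) = (b, M j)" using a(1) b(1) ij(3) by (intro inj_onD[OF Cinj]) auto
    hence "a = b" by simp
    hence "[x + int n' * int i = x + int n' * int j] (mod int (M i))"
      using a(2) b(2) ij(3) by (metis cong_sym cong_trans)
    hence 1: "int (M i) dvd int n' * (int i - int j)"
      by (simp add: cong_iff_dvd_diff right_diff_distrib)
    have "int (M i) dvd int n" using a(1) Cdiv by auto
    hence 2: "int (M i) dvd int n' * int p" using n' by (simp add: mult.commute)
    have "\<not> int p dvd (int i - int j)"
    proof
      assume "int p dvd (int i - int j)"
      hence "int p \<le> \<bar>int i - int j\<bar>" using ij(4) by (intro zdvd_imp_le) auto
      thus False using ij(1,2) by auto
    qed
    hence "coprime (int p) (int i - int j)" using p(1) by (intro prime_imp_coprime) auto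
    then obtain u v where "u * int p + v * (int i - int j) = 1"
      using bezout_int[of "int p" "int i - int j"] by (auto simp: coprime_iff_gcd_eq_1)
    \<comment> \<open>Bezout turns the two divisibilities into \<open>M i dvd n'\<close>.\<close>
    hence "int n' = u * (int n' * int p) + v * (int n' * (int i - int j))"
      by (metis mult.left_commute distrib_left mult.right_neutral)
    also have "int (M i) dvd \<dots>" using 1 2 by simp
    finally show False using M_not_dvd[of i] by simp
  qed
  moreover have "M ` {..<p} \<subseteq> {d. d dvd n}"
  proof
    fix m assume "m \<in> M ` {..<p}"
    then obtain j where "m = M j" by auto
    moreover obtain a where "(a, M j) \<in> C" using M by blast
    ultimately show "m \<in> {d. d dvd n}" using Cdiv by auto
  qed
  ultimately have "card {..<p} \<le> card {d. d dvd n}"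
    using \<open>n > 0\<close> by (intro card_inj_on_le[of M]) auto
  thus ?thesis by (simp add: num_divisors_def)
qed

lemma squarefree_eq_prod_prime_factors:
  fixes c :: nat
  assumes "squarefree c"
  shows "c = \<Prod>(prime_factors c)"
proof -
  have c0: "c \<noteq> 0" using assms by (cases "c = 0") auto
  have "c = (\<Prod>p\<in>prime_factors c. p ^ multiplicity p c)"
    using c0 by (simp add: prime_factorization_nat)
  also have "\<dots> = (\<Prod>p\<in>prime_factors c. p)"
    using assms c0 by (intro prod.cong refl)
      (auto simp: squarefree_factorial_semiring' in_prime_factors_iff prime_multiplicity_other)
  finally show ?thesis .
qed

lemma prod_primes_dvd:
  fixes n :: nat
  assumes "finite T" "\<And>p. p \<in> T \<Longrightarrow> prime p \<and> p dvd n"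
  shows "\<Prod>T dvd n"
  using assms
proof (induction T rule: finite_induct)
  case (insert p T)
  have "coprime p (\<Prod>T)"
    using insert by (intro prod_coprime_right) (metis insertCI primes_coprime)
  thus ?case using insert by (auto intro!: divides_mult)
qed auto

text \<open>
  Products of distinct subsets of \<open>F\<close> are distinct divisors of \<open>n\<close>.
\<close>

lemma two_power_prime_factors_le_num_divisors:
  assumes "n > 0" "finite F" "\<And>p. p \<in> F \<Longrightarrow> prime p \<and> p dvd n"
  shows "2 ^ card F \<le> num_divisors n"
proof -
  have sub: "\<Prod>T dvd n" if "T \<subseteq> F" for T
    using assms finite_subset[OF that assms(2)] that by (intro prod_primes_dvd) auto
  have "T = {p. prime p \<and> p dvd \<Prod>T}" if "T \<subseteq> F" for T
  proof -
    have "finite T" using finite_subset[OF that assms(2)] .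
    moreover have "\<And>p. p \<in> T \<Longrightarrow> prime p" using that assms(3) by auto
    ultimately show ?thesis
      by (auto simp: prime_dvd_prod_iff intro: dvd_prodI) (metis primes_dvd_imp_eq)
  qed
  hence "inj_on (\<lambda>T. \<Prod>T) (Pow F)" by (intro inj_onI) (metis PowD)
  hence "card (Pow F) \<le> card {d. d dvd n}"
    using sub \<open>n > 0\<close> by (intro card_inj_on_le[of "\<lambda>T. \<Prod>T"]) auto
  thus ?thesis using assms(2) by (simp add: card_Pow num_divisors_def)
qed

text \<open>
  The squarefree part of \<open>n\<close> has at most \<open>t = ln \<tau>(n) / ln 2\<close> prime factors, because each of them
  doubles the number of divisors, and each is at most \<open>\<tau>(n)\<close>; so its logarithm is at most
  \<open>t * ln \<tau>(n)\<close>.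
\<close>

lemma primitive_covering_ln_le:
  assumes "primitive_covering_number n"
  shows "ln (real n) \<le> (ln (real (num_divisors n)))\<^sup>2 / ln 2 + 2 * ln (real (square_part n))"
proof -
  define c where "c = squarefree_part n"
  define d where "d = square_part n"
  define t where "t = num_divisors n"
  have n: "n = c * d\<^sup>2" unfolding c_def d_def by (rule squarefree_decompose)
  have n0: "n > 0" using assms by (simp add: primitive_covering_number_def covering_number_def)
  have c0: "c > 0" and d0: "d > 0" using n n0 by (auto intro: Nat.gr0I)
  have t0: "t > 0" unfolding t_def using n0 by (rule num_divisors_pos)
  define r where "r = card (prime_factors c)"
  have pf: "prime p \<and> p dvd n" if "p \<in> prime_factors c" for p
    using that n by (auto simp: in_prime_factors_iff)
  have "2 ^ r \<le> t" unfolding r_def t_def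
    using n0 pf by (intro two_power_prime_factors_le_num_divisors) auto
  hence "real (2 ^ r) \<le> real t" by (simp only: of_nat_le_iff)
  hence "ln (2 ^ r) \<le> ln (real t)" using t0 by (subst ln_le_cancel_iff) auto
  hence r: "real r \<le> ln t / ln 2" by (simp add: ln_realpow field_simps)
  have "c = \<Prod>(prime_factors c)"
    by (rule squarefree_eq_prod_prime_factors) (simp add: c_def)
  also have "\<dots> \<le> (\<Prod>p\<in>prime_factors c. t)"
    using prime_divisor_le_num_divisors[OF assms] pf by (intro prod_mono) (auto simp: t_def)
  also have "\<dots> = t ^ r" by (simp add: r_def)
  finally have "real c \<le> real t ^ r" by (metis of_nat_le_iff of_nat_power)
  hence "ln (real c) \<le> ln (real t ^ r)" using c0 t0 by (subst ln_le_cancel_iff) auto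
  also have "\<dots> = real r * ln t" using t0 by (simp add: ln_realpow)
  also have "\<dots> \<le> (ln t / ln 2) * ln t" using r t0 by (intro mult_right_mono) auto
  finally have "ln (real c) \<le> (ln t)\<^sup>2 / ln 2" by (simp add: power2_eq_square)
  moreover have "ln (real n) = ln (real c) + 2 * ln (real d)"
    using c0 d0 by (subst n) (simp add: ln_mult ln_realpow)
  ultimately show ?thesis by (simp add: t_def d_def)
qed

section \<open>Numbers with many divisors or a large square factor\<close>

lemma num_divisors_mult_le:
  assumes "a > 0" "b > 0"
  shows "num_divisors (a * b) \<le> num_divisors a * num_divisors b"
proof -
  have "{d. d dvd a * b} \<subseteq> (\<lambda>(x, y). x * y) ` ({d. d dvd a} \<times> {d. d dvd b})"
    by (auto simp: image_iff dest!: division_decomp)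
  hence "card {d. d dvd a * b} \<le> card ({d. d dvd a} \<times> {d. d dvd b})"
    using assms by (intro surj_card_le) auto
  thus ?thesis by (simp add: num_divisors_def card_cartesian_product)
qed

text \<open>
  One factor \<open>\<tau>(n)\<close> is spent on summing over factorisations \<open>n = a * b\<close>, and the remaining powers split
  by submultiplicativity, so passing from \<open>s\<close> to \<open>s + 1\<close> at most squares the sum.
\<close>

lemma num_divisors_moment_le:
  "(\<Sum>n=1..N. real (num_divisors n) ^ s / real n) \<le> (\<Sum>n=1..N. 1 / real n) ^ 2 ^ s"
proof (induction s)
  case 0
  show ?case by simp
next
  case (Suc s)
  define f where "f = (\<lambda>n. real (num_divisors n) ^ s / real n)"
  have "(\<Sum>n=1..N. real (num_divisors n) ^ Suc s / real n) = (\<Sum>n=1..N. \<Sum>d | d dvd n. f n)"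
    by (intro sum.cong) (auto simp: f_def num_divisors_def)
  also have "\<dots> = (\<Sum>(n, d)\<in>(SIGMA n:{1..N}. {d. d dvd n}). f n)"
    by (subst sum.Sigma) auto
  also have "\<dots> \<le> (\<Sum>(a, b)\<in>{1..N} \<times> {1..N}. f a * f b)"
  proof (rule sum_le_included[where i = "\<lambda>(a, b). (a * b, a)"])
    show "\<forall>x\<in>(SIGMA n:{1..N}. {d. d dvd n}). \<exists>y\<in>{1..N} \<times> {1..N}.
        (case y of (a, b) \<Rightarrow> (a * b, a)) = x \<and>
        (case x of (n, d) \<Rightarrow> f n) \<le> (case y of (a, b) \<Rightarrow> f a * f b)"
    proof safe
      fix n d assume nd: "n \<in> {1..N}" "d dvd n"
      then obtain e where e: "n = d * e" by (elim dvdE)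
      have de: "d \<in> {1..N}" "e \<in> {1..N}"
        using nd e by (auto intro: Nat.gr0I dvd_imp_le order_trans[OF dvd_imp_le[of _ n]] simp: Suc_le_eq)
      have "real (num_divisors n) \<le> real (num_divisors d) * real (num_divisors e)"
        using num_divisors_mult_le[of d e] de e by (metis atLeastAtMost_iff less_le_trans of_nat_le_iff of_nat_mult zero_less_one)
      hence "real (num_divisors n) ^ s \<le> (real (num_divisors d) * real (num_divisors e)) ^ s"
        by (intro power_mono) auto
      hence "f n \<le> f d * f e" using de e
        by (simp add: f_def power_mult_distrib field_simps)
      thus "\<exists>y\<in>{1..N} \<times> {1..N}. (case y of (a, b) \<Rightarrow> (a * b, a)) = (n, d) \<and>
            f n \<le> (case y of (a, b) \<Rightarrow> f a * f b)"
        using de e by (intro bexI[of _ "(d, e)"]) auto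
    qed
  qed (auto simp: f_def)
  also have "\<dots> = (\<Sum>n=1..N. f n)\<^sup>2"
    by (simp add: power2_eq_square sum_product sum.cartesian_product)
  also have "\<dots> \<le> ((\<Sum>n=1..N. 1 / real n) ^ 2 ^ s)\<^sup>2"
    using Suc.IH by (intro power_mono) (auto simp: f_def intro!: sum_nonneg)
  also have "\<dots> = (\<Sum>n=1..N. 1 / real n) ^ 2 ^ Suc s"
    by (simp add: power_mult[symmetric] mult.commute)
  finally show ?case .
qed

lemma harmonic_le_ln:
  assumes "N \<ge> 1"
  shows "(\<Sum>n=1..N. 1 / real n) \<le> 1 + ln (real N)"
  using assms
proof (induction N rule: dec_induct)
  case base
  show ?case by simp
next
  case (step N)
  have "1 / real (Suc N) \<le> - ln (1 - 1 / real (Suc N))"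
    using ln_le_minus_one[of "1 - 1 / real (Suc N)"] step.hyps by (simp add: field_simps)
  also have "1 - 1 / real (Suc N) = real N / real (Suc N)"
    by (simp add: field_simps)
  also have "- ln (real N / real (Suc N)) = ln (real (Suc N)) - ln (real N)"
    using step.hyps by (subst ln_div) auto
  finally show ?case using step.IH by simp
qed

lemma card_multiples_le: "real (card {n\<in>{1..N}. m dvd n}) \<le> real N / real m" if "m > 0" for m N :: nat
proof -
  have "{n\<in>{1..N}. m dvd n} \<subseteq> (\<lambda>k. m * k) ` {1..N div m}"
  proof
    fix n assume n: "n \<in> {n\<in>{1..N}. m dvd n}"
    then obtain k where k: "n = m * k" by (auto elim: dvdE)
    have "k > 0" using n k by (auto intro: Nat.gr0I)
    moreover have "k \<le> N div m" using n k that by (simp add: less_eq_div_iff_mult_less_eq mult.commute)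
    ultimately show "n \<in> (\<lambda>k. m * k) ` {1..N div m}" using k by auto
  qed
  hence "card {n\<in>{1..N}. m dvd n} \<le> card {1..N div m}"
    by (intro surj_card_le) auto
  hence "real (card {n\<in>{1..N}. m dvd n}) \<le> real (N div m)" by simp
  also have "\<dots> \<le> real N / real m" by (rule of_nat_div_le_of_nat)
  finally show ?thesis .
qed

text \<open>
  Estimating \<open>1 / d\<^sup>2 \<le> 1 / (w * d)\<close> costs a logarithm compared with the true order \<open>N / w\<close>, but leaves
  only a harmonic sum.
\<close>

lemma card_large_square_part_le:
  fixes w :: real
  assumes "w > 0" "N \<ge> 1"
  shows "real (card {n\<in>{1..N}. real (square_part n) > w}) \<le> real N * (1 + ln (real N)) / w"
proof -
  define D where "D = {d\<in>{1..N}. real d > w}"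
  have "{n\<in>{1..N}. real (square_part n) > w} \<subseteq> (\<Union>d\<in>D. {n\<in>{1..N}. d\<^sup>2 dvd n})"
  proof safe
    fix n assume n: "n \<in> {1..N}" "real (square_part n) > w"
    have sq: "(square_part n)\<^sup>2 dvd n" by simp
    hence "square_part n dvd n" by (rule dvd_trans[rotated]) (simp add: power2_eq_square)
    hence "square_part n \<le> n" "square_part n > 0"
      using n by (auto intro: dvd_imp_le Nat.gr0I)
    thus "n \<in> (\<Union>d\<in>D. {n\<in>{1..N}. d\<^sup>2 dvd n})"
      using n sq by (auto simp: D_def intro!: exI[of _ "square_part n"])
  qed
  hence "card {n\<in>{1..N}. real (square_part n) > w} \<le> card (\<Union>d\<in>D. {n\<in>{1..N}. d\<^sup>2 dvd n})"
    by (intro card_mono) (auto simp: D_def)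
  also have "\<dots> \<le> (\<Sum>d\<in>D. card {n\<in>{1..N}. d\<^sup>2 dvd n})"
    by (rule card_UN_le) (simp add: D_def)
  finally have "real (card {n\<in>{1..N}. real (square_part n) > w})
      \<le> (\<Sum>d\<in>D. real (card {n\<in>{1..N}. d\<^sup>2 dvd n}))"
    by (simp flip: of_nat_sum)
  also have "\<dots> \<le> (\<Sum>d\<in>D. real N / w * (1 / real d))"
  proof (rule sum_mono)
    fix d assume d: "d \<in> D"
    have "real (card {n\<in>{1..N}. d\<^sup>2 dvd n}) \<le> real N / real (d\<^sup>2)"
      using d by (intro card_multiples_le) (auto simp: D_def)
    also have "\<dots> \<le> real N / (w * real d)"
      using d assms by (intro divide_left_mono) (auto simp: D_def power2_eq_square)
    finally show "real (card {n\<in>{1..N}. d\<^sup>2 dvd n}) \<le> real N / w * (1 / real d)" by simp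
  qed
  also have "\<dots> = real N / w * (\<Sum>d\<in>D. 1 / real d)" by (simp add: sum_distrib_left)
  also have "(\<Sum>d\<in>D. 1 / real d) \<le> (\<Sum>d=1..N. 1 / real d)"
    by (rule sum_mono2) (auto simp: D_def)
  also have "\<dots> \<le> 1 + ln (real N)" using assms by (intro harmonic_le_ln)
  finally show ?thesis using assms by (simp add: mult_left_mono divide_right_mono)
qed

text \<open>
  Markov's inequality for the \<open>s\<close>-th moment of \<open>\<tau>\<close>.
\<close>

lemma card_many_divisors_le:
  fixes t :: real
  assumes "t > 0" "N \<ge> 1"
  shows "real (card {n\<in>{1..N}. real (num_divisors n) \<ge> t}) \<le> real N * (1 + ln (real N)) ^ 2 ^ s / t ^ s"
proof -
  have "real (card {n\<in>{1..N}. real (num_divisors n) \<ge> t}) = (\<Sum>n | n \<in> {1..N} \<and> real (num_divisors n) \<ge> t. 1)"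
    by simp
  also have "\<dots> \<le> (\<Sum>n | n \<in> {1..N} \<and> real (num_divisors n) \<ge> t. real N / t ^ s * (real (num_divisors n) ^ s / real n))"
  proof (rule sum_mono)
    fix n assume n: "n \<in> {n. n \<in> {1..N} \<and> real (num_divisors n) \<ge> t}"
    have "t ^ s \<le> real (num_divisors n) ^ s" using n assms by (intro power_mono) auto
    hence "1 * 1 \<le> (real N / real n) * (real (num_divisors n) ^ s / t ^ s)"
      using n assms by (intro mult_mono) auto
    thus "1 \<le> real N / t ^ s * (real (num_divisors n) ^ s / real n)" by (simp add: mult_ac)
  qed
  also have "\<dots> \<le> (\<Sum>n=1..N. real N / t ^ s * (real (num_divisors n) ^ s / real n))"
    using assms by (intro sum_mono2) auto
  also have "\<dots> = real N / t ^ s * (\<Sum>n=1..N. real (num_divisors n) ^ s / real n)"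
    by (simp only: sum_distrib_left)
  also have "\<dots> \<le> real N / t ^ s * (1 + ln (real N)) ^ 2 ^ s"
    using assms by (intro mult_left_mono order_trans[OF num_divisors_moment_le] power_mono
        harmonic_le_ln sum_nonneg) auto
  finally show ?thesis by (simp add: field_simps)
qed

section \<open>Counting primitive covering numbers\<close>

text \<open>
  A primitive covering number up to \<open>x\<close> is at most \<open>x / w\<close>, or has a square factor exceeding \<open>w\<^sup>2\<close>, or has
  at least \<open>exp (sqrt (ln 2 * (ln x - 3 * ln w)))\<close> divisors; the three terms count these cases.
\<close>

lemma primitive_covering_count_le:
  fixes x w :: real
  assumes x: "x \<ge> 1" and w: "w > 0" "3 * ln w \<le> ln x"
  shows "real (primitive_covering_count x) \<le>
     x / w + x * (1 + ln x) / w + x * (1 + ln x) ^ 2 ^ s / exp (real s * sqrt (ln 2 * (ln x - 3 * ln w)))"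
proof -
  define N where "N = nat \<lfloor>x\<rfloor>"
  have N: "N \<ge> 1" "real N \<le> x" using x by (auto simp: N_def le_nat_iff le_floor_iff)
  have lnN: "ln (real N) \<le> ln x" "ln (real N) \<ge> 0" using N x by auto
  define t where "t = exp (sqrt (ln 2 * (ln x - 3 * ln w)))"
  define A where "A = {n\<in>{1..N}. real n \<le> x / w}"
  define B where "B = {n\<in>{1..N}. real (square_part n) > w}"
  define C where "C = {n\<in>{1..N}. real (num_divisors n) \<ge> t}"
  have "{n. primitive_covering_number n \<and> real n \<le> x} \<subseteq> A \<union> B \<union> C"
  proof
    fix n assume "n \<in> {n. primitive_covering_number n \<and> real n \<le> x}"
    hence n: "primitive_covering_number n" "real n \<le> x" by auto
    have n0: "n > 0" using n by (simp add: primitive_covering_number_def covering_number_def)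
    have nN: "n \<in> {1..N}" using n n0 by (auto simp: N_def le_nat_iff le_floor_iff)
    show "n \<in> A \<union> B \<union> C"
    proof (rule ccontr)
      assume "n \<notin> A \<union> B \<union> C"
      hence *: "real n > x / w" "real (square_part n) \<le> w" "real (num_divisors n) < t"
        using nN by (auto simp: A_def B_def C_def)
      have sq0: "square_part n > 0" using n0 by (auto intro: Nat.gr0I)
      have tau0: "num_divisors n > 0" using n0 by (rule num_divisors_pos)
      have "ln (x / w) < ln (real n)" using * x w n0 by (subst ln_less_cancel_iff) auto
      hence 1: "ln x - ln w < ln (real n)" using x w by (simp add: ln_div)
      have 2: "ln (real (square_part n)) \<le> ln w" using * sq0 w by (subst ln_le_cancel_iff) auto
      have "ln (real (num_divisors n)) < ln t" using * tau0
        by (subst ln_less_cancel_iff) (auto simp: t_def)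
      hence "(ln (real (num_divisors n)))\<^sup>2 < (sqrt (ln 2 * (ln x - 3 * ln w)))\<^sup>2"
        using tau0 by (intro power_strict_mono) (auto simp: t_def)
      also have "\<dots> = ln 2 * (ln x - 3 * ln w)" using w by simp
      finally have 3: "(ln (real (num_divisors n)))\<^sup>2 / ln 2 < ln x - 3 * ln w"
        by (simp add: field_simps)
      show False using primitive_covering_ln_le[OF n(1)] 1 2 3 by linarith
    qed
  qed
  hence "primitive_covering_count x \<le> card (A \<union> B \<union> C)"
    unfolding primitive_covering_count_def by (intro card_mono) (auto simp: A_def B_def C_def)
  also have "\<dots> \<le> card A + card B + card C"
    using card_Un_le[of "A \<union> B" C] card_Un_le[of A B] by linarith
  finally have "real (primitive_covering_count x) \<le> real (card A) + real (card B) + real (card C)"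
    by linarith
  moreover have "real (card A) \<le> x / w"
  proof -
    have "A \<subseteq> {1..nat \<lfloor>x / w\<rfloor>}" by (auto simp: A_def le_nat_iff le_floor_iff)
    hence "card A \<le> card {1..nat \<lfloor>x / w\<rfloor>}" by (intro card_mono) auto
    hence "card A \<le> nat \<lfloor>x / w\<rfloor>" by simp
    thus ?thesis using x w by (simp add: le_nat_iff le_floor_iff)
  qed
  moreover have "real (card B) \<le> x * (1 + ln x) / w"
  proof -
    have "real (card B) \<le> real N * (1 + ln (real N)) / w"
      unfolding B_def using w N by (intro card_large_square_part_le)
    also have "\<dots> \<le> x * (1 + ln x) / w"
      using w N lnN x by (intro divide_right_mono mult_mono) auto
    finally show ?thesis .
  qed
  moreover have "real (card C) \<le> x * (1 + ln x) ^ 2 ^ s / t ^ s"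
  proof -
    have "real (card C) \<le> real N * (1 + ln (real N)) ^ 2 ^ s / t ^ s"
      unfolding C_def using N by (intro card_many_divisors_le) (auto simp: t_def)
    also have "\<dots> \<le> x * (1 + ln x) ^ 2 ^ s / t ^ s"
      using N lnN x by (intro divide_right_mono mult_mono power_mono) (auto simp: t_def)
    finally show ?thesis .
  qed
  moreover have "t ^ s = exp (real s * sqrt (ln 2 * (ln x - 3 * ln w)))"
    by (simp add: t_def exp_of_nat_mult)
  ultimately show ?thesis by simp
qed

text \<open>
  The cutoff \<open>w = exp (sqrt L * ln L)\<close> makes the first two cases negligible, since
  \<open>1 / (2 * sqrt (ln 2)) < 1\<close>, while \<open>ln w\<close> is still \<open>o(L)\<close>. The moment is taken of order about
  \<open>a * ln L / ln 2\<close> with \<open>a < 1 / 2\<close>: then \<open>2 ^ s \<le> L powr a\<close> keeps \<open>(1 + L) ^ 2 ^ s\<close> below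
  \<open>exp (o(sqrt L))\<close>, and the gain is \<open>exp (a / sqrt (ln 2) * sqrt L * ln L)\<close>.
\<close>

lemma primitive_covering_count_asymp:
  fixes \<epsilon> :: real
  assumes "\<epsilon> > 0"
  shows "\<forall>\<^sub>F x in at_top. real (primitive_covering_count x)
           \<le> x * exp (- ((1 / (2 * sqrt (ln 2)) - \<epsilon>) * (sqrt (ln x) * ln (ln x))))"
proof -
  define c where "c = 1 / (2 * sqrt (ln 2 :: real))"
  \<comment> \<open>Shrinking \<open>\<epsilon>\<close> to at most \<open>c\<close> keeps the moment order \<open>a\<close> positive.\<close>
  define e where "e = min \<epsilon> c"
  define a where "a = (c - e / 2) * sqrt (ln 2)"
  have ln2: "sqrt (ln 2 :: real) > 1 / 2"
  proof (rule real_less_rsqrt)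
    show "(1 / 2)\<^sup>2 < ln (2 :: real)"
      using ln_le_minus_one[of "1 / 2 :: real"] by (simp add: ln_div power2_eq_square)
  qed
  have "c > 0" "c < 1" using ln2 by (auto simp: c_def field_simps)
  hence e: "e > 0" "e \<le> c" "e \<le> \<epsilon>" using assms by (auto simp: e_def)
  have c_sqrt: "c * sqrt (ln 2) = 1 / 2" using ln2 by (simp add: c_def)
  have "a > 0" unfolding a_def using e \<open>c > 0\<close> ln2 by (intro mult_pos_pos) auto
  moreover have "a = 1 / 2 - e / 2 * sqrt (ln 2)" using c_sqrt by (simp add: a_def left_diff_distrib)
  moreover have "e / 2 * sqrt (ln 2) > 0" using e ln2 by (intro mult_pos_pos) auto
  ultimately have a: "a > 0" "a < 1 / 2" by auto
  define G where "G = (\<lambda>L::real. sqrt L * ln L)"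
  define E where "E = (\<lambda>L::real. L powr a * ln (1 + L) - (a / ln 2 * ln L - 1) * sqrt (ln 2 * (L - 3 * G L)))"
  have sqrt2: "ln 2 powr (1/2) = sqrt (ln 2 :: real)" by (simp add: powr_half_sqrt)
  have lim_E: "((\<lambda>L. (E L + ln 2) / G L) \<longlongrightarrow> - (a * ln 2 powr (1/2) / ln 2)) at_top"
    using a unfolding E_def G_def by real_asymp
  have "a * sqrt (ln 2) / ln 2 = a / sqrt (ln 2)"
    by (metis divide_divide_eq_right ln_2_less_1 ln_gt_zero one_less_numeral_iff real_div_sqrt
        real_sqrt_gt_zero semiring_norm(76) times_divide_eq_right less_imp_le)
  also have "a / sqrt (ln 2) = c - e / 2" using ln2 by (simp add: a_def)
  finally have "- (a * ln 2 powr (1/2) / ln 2) < - (c - e)" using e by (simp add: sqrt2)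
  with lim_E have ev_E: "\<forall>\<^sub>F L in at_top. (E L + ln 2) / G L < - (c - e)"
    by (rule order_tendstoD)
  have "((\<lambda>L. (ln (2 + L) - G L + ln 2) / G L) \<longlongrightarrow> - 1) at_top"
    unfolding G_def by real_asymp
  moreover have "- 1 < - (c - e)" using e \<open>c < 1\<close> by simp
  ultimately have ev_1: "\<forall>\<^sub>F L in at_top. (ln (2 + L) - G L + ln 2) / G L < - (c - e)"
    by (rule order_tendstoD)
  have ev_2: "\<forall>\<^sub>F L in at_top. 3 * G L \<le> L" unfolding G_def by real_asymp
  have ev_3: "\<forall>\<^sub>F L in at_top. G L > 0" unfolding G_def by real_asymp
  have "filterlim (ln :: real \<Rightarrow> real) at_top at_top" by (rule ln_at_top)
  hence lift: "\<forall>\<^sub>F x in at_top. P (ln x)" if "eventually P at_top" for P :: "real \<Rightarrow> bool"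
    using that by (auto simp: filterlim_iff)
  show ?thesis
    using lift[OF ev_E] lift[OF ev_1] lift[OF ev_2] lift[OF ev_3] lift[OF eventually_ge_at_top[of 1]]
      eventually_ge_at_top[of 1]
  proof eventually_elim
    case (elim x)
    define L where "L = ln x"
    define w where "w = exp (G L)"
    define s where "s = nat \<lfloor>a / ln 2 * ln L\<rfloor>"
    have L: "L \<ge> 1" "x = exp L" using elim by (auto simp: L_def)
    have G: "G L > 0" "3 * G L \<le> L" using elim by (auto simp: L_def)
    have exp_le: "exp y \<le> exp (- (c - e) * G L) / 2" if "(y + ln 2) / G L < - (c - e)" for y
    proof -
      have "y + ln 2 \<le> - (c - e) * G L" using that G by (simp add: field_simps)
      hence "exp (y + ln 2) \<le> exp (- (c - e) * G L)" by simp
      thus ?thesis by (simp add: exp_add)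
    qed
    have s_le: "real s \<le> a / ln 2 * ln L"
      using a L unfolding s_def by (subst of_nat_nat) auto
    have s_ge: "a / ln 2 * ln L - 1 \<le> real s" by (simp add: s_def) linarith
    have "(2::real) ^ s = 2 powr real s" by (simp add: powr_realpow)
    also have "\<dots> \<le> 2 powr (a / ln 2 * ln L)" using s_le by simp
    also have "\<dots> = L powr a" using L by (simp add: powr_def)
    finally have two_s: "(2::real) ^ s \<le> L powr a" .
    have "(1 + L) ^ 2 ^ s = exp (2 ^ s * ln (1 + L))"
      using L exp_of_nat_mult[of "2 ^ s" "ln (1 + L)"] by simp
    also have "\<dots> \<le> exp (L powr a * ln (1 + L))"
      using two_s L by (simp add: mult_right_mono)
    finally have 1: "(1 + L) ^ 2 ^ s \<le> exp (L powr a * ln (1 + L))" .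
    have "(a / ln 2 * ln L - 1) * sqrt (ln 2 * (L - 3 * G L)) \<le> real s * sqrt (ln 2 * (L - 3 * G L))"
      using s_ge G by (intro mult_right_mono) auto
    hence "(1 + L) ^ 2 ^ s / exp (real s * sqrt (ln 2 * (L - 3 * G L)))
        \<le> exp (L powr a * ln (1 + L)) / exp ((a / ln 2 * ln L - 1) * sqrt (ln 2 * (L - 3 * G L)))"
      using 1 L by (intro frac_le) auto
    also have "\<dots> = exp (E L)" by (simp add: E_def exp_diff)
    also have "\<dots> \<le> exp (- (c - e) * G L) / 2" using elim by (intro exp_le) (simp add: L_def)
    finally have 2: "(1 + L) ^ 2 ^ s / exp (real s * sqrt (ln 2 * (L - 3 * G L)))
        \<le> exp (- (c - e) * G L) / 2" .
    have "(2 + L) / w = exp (ln (2 + L) - G L)" using L by (simp add: w_def exp_diff)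
    also have "\<dots> \<le> exp (- (c - e) * G L) / 2" using elim by (intro exp_le) (simp add: L_def)
    finally have 3: "(2 + L) / w \<le> exp (- (c - e) * G L) / 2" .
    have "real (primitive_covering_count x) \<le>
        x / w + x * (1 + L) / w + x * (1 + L) ^ 2 ^ s / exp (real s * sqrt (ln 2 * (L - 3 * G L)))"
      using primitive_covering_count_le[of x w s] elim by (simp add: L_def w_def)
    also have "\<dots> = x * ((2 + L) / w + (1 + L) ^ 2 ^ s / exp (real s * sqrt (ln 2 * (L - 3 * G L))))"
      by (simp add: algebra_simps add_divide_distrib)
    also have "\<dots> \<le> x * exp (- (c - e) * G L)"
      using add_mono[OF 3 2] L by (intro mult_left_mono) (simp_all only: field_sum_of_halves exp_ge_zero)
    also have "\<dots> \<le> x * exp (- (c - \<epsilon>) * G L)"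
      using e G L by (auto intro!: mult_right_mono)
    finally show ?case by (simp only: c_def G_def L_def mult_minus_left)
  qed
qed

section \<open>Chebyshev bounds at powers of two\<close>

definition prime_count :: "nat \<Rightarrow> nat" where
  "prime_count n = card {p. prime p \<and> p \<le> n}"

lemma finite_primes_le [simp]: "finite {p::nat. prime p \<and> p \<le> n}"
  by (rule finite_subset[of _ "{..n}"]) auto

text \<open>
  The identity \<open>1 / ((k + 1) * (n choose (k + 1))) = 1 / (k * ((n - 1) choose k)) - 1 / (k * (n choose k))\<close>
  (the rule of Leibniz' harmonic triangle) shows by induction on \<open>k\<close> that \<open>L\<close> times the left-hand side
  is an integer.
\<close>

lemma binomial_dvd_common_multiple:
  assumes "k \<ge> 1" "k \<le> n" "\<And>i. 1 \<le> i \<Longrightarrow> i \<le> n \<Longrightarrow> i dvd L"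
  shows "k * (n choose k) dvd L"
  using assms
proof (induction k arbitrary: n rule: dec_induct)
  case base
  thus ?case by simp
next
  case (step k)
  then obtain m where m: "n = Suc m" by (cases n) auto
  have "k * (m choose k) dvd L" "k * (n choose k) dvd L"
    using step m by auto
  then obtain u v where u: "L = k * (m choose k) * u" and v: "L = k * (n choose k) * v"
    by (elim dvdE)
  have X1: "Suc k * (n choose Suc k) = n * (m choose k)"
    using Suc_times_binomial_eq[of m k] by (simp only: m mult.commute)
  have X2: "Suc k * (n choose Suc k) = (n - k) * (n choose k)"
    using binomial_absorption[of k n] binomial_absorb_comp[of n k] by simp
  define X where "X = int (Suc k * (n choose Suc k))"
  have "int k * X * int u = int n * int L"
    using X1 u by (simp add: X_def)
  moreover have "int k * X * int v = (int n - int k) * int L"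
    using X2 v step.prems step.hyps by (simp add: X_def of_nat_diff)
  ultimately have "int k * (X * (int u - int v)) = int k * int L"
    by (simp add: algebra_simps)
  hence "int L = X * (int u - int v)" using step.hyps by simp
  hence "X dvd int L" by simp
  thus ?case unfolding X_def by (simp only: of_nat_dvd_iff)
qed

text \<open>
  The least common multiple of \<open>1, \<dots>, N\<close> is a product of prime powers, one for each prime up to
  \<open>N\<close>, and none of them exceeds \<open>N\<close>.
\<close>

lemma small_common_multiple:
  obtains L where "L > 0" "\<And>i. 1 \<le> i \<Longrightarrow> i \<le> N \<Longrightarrow> i dvd L" "L \<le> N ^ prime_count N"
proof (cases "N = 0")
  case True
  have "prime_count 0 = 0" unfolding prime_count_def by (auto dest: prime_gt_0_nat)
  thus ?thesis using True that[of 1] by simp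
next
  case False
  define P where "P = {p::nat. prime p \<and> p \<le> N}"
  define e where "e = (\<lambda>p. Max ((\<lambda>i. multiplicity p i) ` {1..N}))"
  have fin: "finite P" by (simp add: P_def)
  have e_ge: "multiplicity p i \<le> e p" if "1 \<le> i" "i \<le> N" for p i
    using that unfolding e_def by (intro Max_ge) auto
  have e_le: "p ^ e p \<le> N" for p
  proof -
    have "e p \<in> (\<lambda>i. multiplicity p i) ` {1..N}" using False unfolding e_def by (intro Max_in) auto
    then obtain i where i: "i \<in> {1..N}" "e p = multiplicity p i" by auto
    have "p ^ multiplicity p i dvd i" by (rule multiplicity_dvd)
    thus ?thesis using i by (auto dest!: dvd_imp_le)
  qed
  define L where "L = (\<Prod>p\<in>P. p ^ e p)"
  show ?thesis
  proof (rule that)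
    show "L > 0" unfolding L_def by (intro prod_pos) (auto simp: P_def prime_gt_0_nat)
    show "i dvd L" if i: "1 \<le> i" "i \<le> N" for i
    proof -
      have "i = (\<Prod>p\<in>prime_factors i. p ^ multiplicity p i)"
        using i by (simp add: prime_factorization_nat)
      also have "\<dots> dvd (\<Prod>p\<in>prime_factors i. p ^ e p)"
        using i by (intro prod_dvd_prod le_imp_power_dvd e_ge)
      also have "\<dots> dvd L" unfolding L_def
      proof (rule prod_dvd_prod_subset[OF fin])
        show "prime_factors i \<subseteq> P"
        proof
          fix p assume "p \<in> prime_factors i"
          hence "prime p" "p dvd i" by (auto simp: in_prime_factors_iff)
          moreover have "p \<le> i" using \<open>p dvd i\<close> i by (intro dvd_imp_le) auto
          ultimately show "p \<in> P" using i by (simp add: P_def)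
        qed
      qed
      finally show ?thesis .
    qed
    have "L \<le> (\<Prod>p\<in>P. N)" unfolding L_def by (intro prod_mono) (auto simp: e_le)
    thus "L \<le> N ^ prime_count N" by (simp add: prime_count_def P_def)
  qed
qed

text \<open>
  With \<open>2 * n = 2 ^ j\<close>, the number \<open>n * (2 * n choose n)\<close>, which is at least \<open>4 ^ n / 2\<close>, divides a common multiple
  of size at most \<open>(2 * n) ^ \<pi>(2 * n)\<close>.
\<close>

lemma prime_count_two_power_lower:
  assumes "j \<ge> 1"
  shows "2 ^ j \<le> Suc (j * prime_count (2 ^ j))"
proof -
  obtain i where i: "j = Suc i" using assms by (cases j) auto
  define n :: nat where "n = 2 ^ i"
  have n: "n > 0" "2 * n = 2 ^ j" by (simp_all add: n_def i)
  obtain L where L: "L > 0" "\<And>i. 1 \<le> i \<Longrightarrow> i \<le> 2 * n \<Longrightarrow> i dvd L"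
      "L \<le> (2 * n) ^ prime_count (2 * n)"
    using small_common_multiple[of "2 * n"] by blast
  have "n * ((2 * n) choose n) dvd L"
    using n L(2) by (intro binomial_dvd_common_multiple) auto
  hence "n * ((2 * n) choose n) \<le> L" using L(1) by (intro dvd_imp_le) auto
  also have "L \<le> (2 * n) ^ prime_count (2 * n)" by (rule L)
  also have "\<dots> = 2 ^ (j * prime_count (2 ^ j))" by (simp only: n(2) power_mult)
  finally have "real (n * ((2 * n) choose n)) \<le> real (2 ^ (j * prime_count (2 ^ j)))"
    by (simp only: of_nat_le_iff)
  hence 1: "real n * real ((2 * n) choose n) \<le> 2 ^ (j * prime_count (2 ^ j))" by simp
  have "real n * (4 ^ n / (2 * real n)) \<le> real n * real ((2 * n) choose n)"
    using n central_binomial_lower_bound[of n] by (intro mult_left_mono) auto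
  hence "4 ^ n \<le> 2 * (real n * real ((2 * n) choose n))" using n by simp
  also have "\<dots> \<le> 2 ^ Suc (j * prime_count (2 ^ j))" using 1 by simp
  finally have "(2::real) ^ (2 ^ j) \<le> 2 ^ Suc (j * prime_count (2 ^ j))"
    by (simp add: n(2)[symmetric] power_mult)
  thus ?thesis by (subst (asm) power_increasing_iff) auto
qed

text \<open>
  All primes in \<open>(n, 2 * n]\<close>, for \<open>n = 2 ^ j\<close>, divide \<open>2 * n choose n\<close>, which is at most \<open>4 ^ n\<close>.
\<close>

lemma prime_count_double:
  "j * card {p. prime p \<and> (2::nat) ^ j < p \<and> p \<le> 2 ^ Suc j} \<le> 2 * (2::nat) ^ j"
proof -
  define n :: nat where "n = 2 ^ j"
  define D where "D = {p. prime p \<and> n < p \<and> p \<le> 2 * n}"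
  have fin: "finite D" unfolding D_def by (rule finite_subset[of _ "{..2 * n}"]) auto
  have "p dvd ((2 * n) choose n)" if "p \<in> D" for p
  proof -
    have p: "prime p" "n < p" "p \<le> 2 * n" using that by (auto simp: D_def)
    have "p dvd fact (2 * n)" using p by (simp add: prime_dvd_fact_iff)
    also have "fact (2 * n) = fact n * fact n * ((2 * n) choose n)"
      using binomial_fact_lemma[of n "2 * n"] by simp
    finally show ?thesis using p by (simp add: prime_dvd_mult_iff prime_dvd_fact_iff)
  qed
  hence "\<Prod>D dvd ((2 * n) choose n)" using fin by (intro prod_primes_dvd) (auto simp: D_def)
  hence "\<Prod>D \<le> ((2 * n) choose n)" by (intro dvd_imp_le) auto
  also have "\<dots> \<le> 2 ^ (2 * n)" by (rule binomial_le_pow2)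
  finally have "\<Prod>D \<le> 2 ^ (2 * n)" .
  moreover have "(\<Prod>p\<in>D. n) \<le> \<Prod>D" by (intro prod_mono) (auto simp: D_def)
  ultimately have "n ^ card D \<le> 2 ^ (2 * n)" by simp
  hence "(2::nat) ^ (j * card D) \<le> 2 ^ (2 * n)" by (simp add: n_def power_mult)
  hence "j * card D \<le> 2 * n" by (subst (asm) power_increasing_iff) auto
  thus ?thesis by (simp add: D_def n_def)
qed

lemma prime_count_split:
  assumes "m \<le> n"
  shows "prime_count n = prime_count m + card {p. prime p \<and> m < p \<and> p \<le> n}"
proof -
  have "{p. prime p \<and> p \<le> n} = {p. prime p \<and> p \<le> m} \<union> {p. prime p \<and> m < p \<and> p \<le> n}"
    using assms by auto
  thus ?thesis unfolding prime_count_def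
    by (subst card_Un_disjoint[symmetric]) (auto intro: finite_subset[of _ "{..n}"])
qed

lemma prime_count_two_power_upper:
  assumes "j \<ge> 3"
  shows "j * prime_count (2 ^ j) \<le> 4 * 2 ^ j"
  using assms
proof (induction j rule: dec_induct)
  case base
  have "prime_count (2 ^ 3) \<le> card {1..8::nat}" unfolding prime_count_def
    by (intro card_mono) (auto dest: prime_gt_0_nat)
  thus ?case by simp
next
  case (step j)
  define X where "X = prime_count (2 ^ Suc j)"
  have "j * X \<le> 6 * 2 ^ j"
    using prime_count_split[of "2 ^ j" "2 ^ Suc j"] prime_count_double[of j] step.IH
    by (simp add: X_def add_mult_distrib2)
  hence "Suc j * (j * X) \<le> Suc j * (6 * 2 ^ j)" by (rule mult_le_mono2)
  also have "\<dots> = (6 * j + 6) * 2 ^ j" by (simp add: algebra_simps)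
  also have "\<dots> \<le> (8 * j) * 2 ^ j" using step.hyps by (intro mult_le_mono1) simp
  finally have "j * (Suc j * X) \<le> j * (4 * 2 ^ Suc j)" by (simp add: algebra_simps)
  moreover have "0 < j" using step.hyps by simp
  ultimately have "Suc j * X \<le> 4 * 2 ^ Suc j" by (simp only: mult_le_cancel1)
  thus ?case by (simp only: X_def)
qed

text \<open>
  The lower constant \<open>1\<close> and the upper constant \<open>4\<close> are separated by the ratio \<open>8\<close> of the
  endpoints. A bounded ratio matters later: it keeps all chosen primes within a constant factor of each
  other.
\<close>

lemma many_primes_between:
  assumes "j \<ge> 9"
  shows "2 ^ j \<le> j * card {p. prime p \<and> 2 ^ j < p \<and> p \<le> (2::nat) ^ (j + 3)}"
proof -
  define a where "a = real (prime_count (2 ^ j))"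
  define b where "b = real (prime_count (2 ^ (j + 3)))"
  define X where "X = card {p. prime p \<and> 2 ^ j < p \<and> p \<le> (2::nat) ^ (j + 3)}"
  have X: "b = a + real X"
    using prime_count_split[of "2 ^ j" "2 ^ (j + 3)"] by (simp add: a_def b_def X_def power_increasing)
  have "real (j * prime_count (2 ^ j)) \<le> real (4 * 2 ^ j)"
    using prime_count_two_power_upper[of j] assms by (simp only: of_nat_le_iff)
  hence 1: "real j * a \<le> 4 * 2 ^ j" by (simp add: a_def)
  have "real (2 ^ (j + 3)) \<le> real (Suc ((j + 3) * prime_count (2 ^ (j + 3))))"
    using prime_count_two_power_lower[of "j + 3"] by (simp only: of_nat_le_iff)
  hence 2: "8 * 2 ^ j \<le> 1 + (real j + 3) * b" by (simp add: b_def power_add mult_ac)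
  have "(real j + 3) * b \<le> (4 / 3 * real j) * b" using assms by (intro mult_right_mono) (auto simp: b_def)
  also have "\<dots> = 4 / 3 * (real j * b)" by simp
  finally have 3: "6 * 2 ^ j \<le> 3 / 4 + real j * b" using 2 by linarith
  have 4: "(1::real) \<le> 2 ^ j" by simp
  have "real j * b = real j * a + real j * real X" using X by (simp add: distrib_left)
  hence "2 ^ j \<le> real j * real X" using 1 3 4 by linarith
  thus ?thesis unfolding X_def by (metis of_nat_le_iff of_nat_mult of_nat_numeral of_nat_power)
qed

section \<open>Abundancy and primitive abundant divisors\<close>

definition abundancy :: "nat \<Rightarrow> real" where
  "abundancy n = real (divisor_sum n) / real n"

lemma nondeficient_iff: "n > 0 \<Longrightarrow> divisor_sum n \<ge> 2 * n \<longleftrightarrow> abundancy n \<ge> 2"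
  using of_nat_le_iff[of "2 * n" "divisor_sum n", where 'a = real]
  by (simp add: abundancy_def field_simps)

lemma abundancy_mono:
  assumes "a dvd b" "b > 0"
  shows "abundancy a \<le> abundancy b"
proof -
  obtain c where c: "b = a * c" using assms(1) by (elim dvdE)
  have pos: "a > 0" "c > 0" using c assms(2) by (auto intro: Nat.gr0I)
  have "divisor_sum a * c = (\<Sum>d\<in>(\<lambda>d. d * c) ` {d. d dvd a}. d)"
    using pos by (subst sum.reindex) (auto simp: inj_on_def divisor_sum_def sum_distrib_right)
  also have "\<dots> \<le> divisor_sum b" unfolding divisor_sum_def
    using assms c by (intro sum_mono2) auto
  finally have "real (divisor_sum a) * real c \<le> real (divisor_sum b)"
    by (simp flip: of_nat_mult)
  thus ?thesis using pos by (simp add: abundancy_def c field_simps)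
qed

lemma abundancy_mult_prime:
  assumes "prime p" "\<not> p dvd n" "n > 0"
  shows "abundancy (n * p) = abundancy n * (1 + 1 / real p)"
proof -
  have "{d. d dvd n * p} = {d. d dvd n} \<union> (\<lambda>d. d * p) ` {d. d dvd n}"
  proof (intro equalityI subsetI)
    fix d assume "d \<in> {d. d dvd n * p}"
    then obtain x y where xy: "d = x * y" "x dvd n" "y dvd p" using division_decomp[of d n p] by auto
    hence "y = 1 \<or> y = p" using assms(1) by (simp add: prime_nat_iff)
    thus "d \<in> {d. d dvd n} \<union> (\<lambda>d. d * p) ` {d. d dvd n}" using xy by auto
  qed auto
  moreover have "{d. d dvd n} \<inter> (\<lambda>d. d * p) ` {d. d dvd n} = {}"
    using assms(2) by (auto dest: dvd_mult_right)
  ultimately have "divisor_sum (n * p) = divisor_sum n + (\<Sum>d\<in>(\<lambda>d. d * p) ` {d. d dvd n}. d)"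
    using assms(3) by (simp add: divisor_sum_def sum.union_disjoint)
  also have "(\<Sum>d\<in>(\<lambda>d. d * p) ` {d. d dvd n}. d) = divisor_sum n * p"
    using prime_gt_0_nat[OF assms(1)]
    by (subst sum.reindex) (auto simp: inj_on_def divisor_sum_def sum_distrib_right)
  finally show ?thesis
    using assms(3) prime_gt_0_nat[OF assms(1)] by (simp add: abundancy_def field_simps)
qed

lemma abundancy_two_power: "abundancy (2 ^ l) = 2 * (1 - 1 / 2 ^ Suc l)"
proof -
  have "{d. d dvd (2::nat) ^ l} = (\<lambda>i. 2 ^ i) ` {..l}"
    by (auto simp: divides_primepow_nat le_imp_power_dvd)
  hence "divisor_sum (2 ^ l) = (\<Sum>i\<le>l. 2 ^ i)"
    unfolding divisor_sum_def by (simp add: sum.reindex inj_on_def)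
  also have "\<dots> = 2 ^ Suc l - 1" by (induction l) auto
  finally have "real (divisor_sum (2 ^ l)) = 2 ^ Suc l - 1" by (simp add: of_nat_diff)
  thus ?thesis by (simp add: abundancy_def field_simps)
qed

lemma prime_dvd_two_power_prod_primes:
  fixes S :: "nat set"
  assumes "finite S" "\<And>p. p \<in> S \<Longrightarrow> prime p" "prime q" "q \<noteq> 2" "q dvd 2 ^ l * \<Prod>S"
  shows "q \<in> S"
proof -
  have "\<not> q dvd 2 ^ l" using assms(3,4) by (metis prime_dvd_power primes_dvd_imp_eq two_is_prime_nat)
  hence "q dvd \<Prod>S" using assms(3,5) by (simp add: prime_dvd_mult_iff)
  then obtain p where "p \<in> S" "q dvd p" using assms(1,3) by (auto simp: prime_dvd_prod_iff)
  moreover from this have "q = p" using assms(2,3) by (intro primes_dvd_imp_eq)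
  ultimately show ?thesis by simp
qed

lemma abundancy_two_power_prod_primes:
  fixes S :: "nat set"
  assumes "finite S" "\<And>p. p \<in> S \<Longrightarrow> prime p \<and> p \<noteq> 2"
  shows "abundancy (2 ^ l * \<Prod>S) = abundancy (2 ^ l) * (\<Prod>p\<in>S. 1 + 1 / real p)"
  using assms
proof (induction S rule: finite_induct)
  case (insert q S)
  have q: "prime q" "q \<noteq> 2" and S: "\<And>p. p \<in> S \<Longrightarrow> prime p" using insert.prems by auto
  have "\<not> q dvd 2 ^ l * \<Prod>S"
    using prime_dvd_two_power_prod_primes[OF insert.hyps(1) S q] insert.hyps(2) by blast
  moreover have "\<Prod>S > 0" using S by (intro prod_pos) (auto simp: prime_gt_0_nat)
  ultimately have "abundancy (2 ^ l * \<Prod>S * q) = abundancy (2 ^ l * \<Prod>S) * (1 + 1 / real q)"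
    using q by (intro abundancy_mult_prime) auto
  moreover have "abundancy (2 ^ l * \<Prod>S) = abundancy (2 ^ l) * (\<Prod>p\<in>S. 1 + 1 / real p)"
    using insert.prems by (intro insert.IH) auto
  ultimately show ?case using insert.hyps by (simp add: mult_ac)
qed simp

lemma primitive_abundant_divisor_exists:
  assumes "N > 0" "abundancy N \<ge> 2"
  obtains n where "n dvd N" "primitive_abundant n"
proof -
  define Q where "Q = (\<lambda>n. n dvd N \<and> divisor_sum n \<ge> 2 * n)"
  define n where "n = (LEAST n. Q n)"
  have "Q N" using assms by (simp add: Q_def nondeficient_iff)
  hence n: "Q n" unfolding n_def by (rule LeastI)
  hence n0: "n > 0" using assms(1) by (auto simp: Q_def intro: Nat.gr0I)
  have "\<not> divisor_sum d \<ge> 2 * d" if "d dvd n" "d \<noteq> n" for d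
  proof
    assume "divisor_sum d \<ge> 2 * d"
    hence "Q d" using that n by (auto simp: Q_def intro: dvd_trans)
    hence "n \<le> d" unfolding n_def by (rule Least_le)
    thus False using that n0 dvd_imp_le[of d n] by simp
  qed
  hence "primitive_abundant n" using n n0 by (auto simp: primitive_abundant_def Q_def)
  thus ?thesis using n that by (auto simp: Q_def)
qed

text \<open>
  Every element of \<open>S\<close> that a nondeficient divisor \<open>n\<close> omits costs a factor of at least \<open>1 + 1 / M\<close> in
  abundancy, whatever power of \<open>2\<close> survives in \<open>n\<close>. The total loss is at most \<open>B\<close>, so at most \<open>D\<close>
  elements are omitted.
\<close>

lemma nondeficient_divisor_cofactor_le:
  fixes S :: "nat set"
  assumes S: "finite S" "\<And>p. p \<in> S \<Longrightarrow> prime p \<and> p \<noteq> 2 \<and> p \<le> M" and M: "M \<ge> 1"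
    and abund: "abundancy (2 ^ l * \<Prod>S) \<le> 2 * B" and B: "B < (1 + 1 / real M) ^ Suc D"
    and n: "n dvd 2 ^ l * \<Prod>S" "abundancy n \<ge> 2"
  shows "2 ^ l * \<Prod>S \<le> n * (2 ^ l * M ^ D)"
proof -
  define T where "T = {p\<in>S. p dvd n}"
  define E where "E = S - T"
  have fin: "finite T" "finite E" and ST: "S = T \<union> E" "T \<inter> E = {}"
    using S(1) by (auto simp: T_def E_def)
  have prod_split: "\<Prod>S = \<Prod>T * \<Prod>E" using fin ST by (simp add: prod.union_disjoint)
  have "\<Prod>S > 0" using S by (intro prod_pos) (auto simp: prime_gt_0_nat)
  hence pos: "\<Prod>T > 0" "2 ^ l * \<Prod>S > 0" by (auto simp: prod_split)
  hence n0: "n > 0" using n(1) by (auto intro: Nat.gr0I)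
  have "coprime n (\<Prod>E)"
    using S by (intro prod_coprime_right) (auto simp: E_def T_def coprime_commute intro: prime_imp_coprime)
  hence "n dvd 2 ^ l * \<Prod>T"
    using n(1) by (simp add: prod_split coprime_dvd_mult_left_iff flip: mult.assoc)
  hence "abundancy n \<le> abundancy (2 ^ l * \<Prod>T)" using pos by (intro abundancy_mono) auto
  hence "2 \<le> abundancy (2 ^ l) * (\<Prod>p\<in>T. 1 + 1 / real p)"
    using abundancy_two_power_prod_primes[of T l] fin S(2) n(2) by (auto simp: T_def)
  moreover have "(1 + 1 / real M) ^ card E \<le> (\<Prod>p\<in>E. 1 + 1 / real p)"
  proof -
    have "(\<Prod>p\<in>E. 1 + 1 / real M) \<le> (\<Prod>p\<in>E. 1 + 1 / real p)"
    proof (rule prod_mono)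
      fix p assume "p \<in> E"
      hence "p \<le> M" "p > 0" using S(2) by (auto simp: E_def prime_gt_0_nat)
      thus "0 \<le> 1 + 1 / real M \<and> 1 + 1 / real M \<le> 1 + 1 / real p"
        by (simp add: frac_le)
    qed
    thus ?thesis by simp
  qed
  ultimately have "2 * (1 + 1 / real M) ^ card E
      \<le> abundancy (2 ^ l) * (\<Prod>p\<in>T. 1 + 1 / real p) * (\<Prod>p\<in>E. 1 + 1 / real p)"
    by (intro mult_mono) auto
  also have "\<dots> = abundancy (2 ^ l) * (\<Prod>p\<in>S. 1 + 1 / real p)"
    using fin ST by (simp add: prod.union_disjoint)
  also have "\<dots> = abundancy (2 ^ l * \<Prod>S)"
    using S by (intro abundancy_two_power_prod_primes[symmetric]) auto
  also have "\<dots> < 2 * (1 + 1 / real M) ^ Suc D" using abund B by linarith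
  finally have "(1 + 1 / real M) ^ card E < (1 + 1 / real M) ^ Suc D" by simp
  hence "card E < Suc D" using M by (subst (asm) power_strict_increasing_iff) auto
  hence card_E: "card E \<le> D" by simp
  have "\<Prod>T dvd n" using fin S(2) by (intro prod_primes_dvd) (auto simp: T_def)
  hence T_le: "\<Prod>T \<le> n" using n0 by (intro dvd_imp_le)
  have "\<Prod>E \<le> (\<Prod>p\<in>E. M)" using S(2) by (intro prod_mono) (auto simp: E_def)
  also have "\<dots> \<le> M ^ D" using card_E M by (simp add: power_increasing)
  finally have "\<Prod>T * \<Prod>E \<le> n * M ^ D" using T_le by (intro mult_mono) auto
  thus ?thesis by (simp add: prod_split)
qed

text \<open>
  Choose a primitive abundant divisor \<open>f S\<close> of \<open>N S = 2 ^ l * \<Prod>S\<close> for every \<open>S\<close>. The pair of \<open>f S\<close> and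
  its cofactor recovers \<open>N S\<close>, hence \<open>S\<close>, and there are few possible cofactors.
\<close>

lemma card_family_le_primitive_abundant_count:
  fixes F :: "nat set set" and x :: real
  assumes F: "\<And>S p. S \<in> F \<Longrightarrow> finite S"
      "\<And>S p. S \<in> F \<Longrightarrow> p \<in> S \<Longrightarrow> prime p \<and> p \<noteq> 2 \<and> p \<le> M"
    and M: "M \<ge> 1"
    and abund: "\<And>S. S \<in> F \<Longrightarrow> 2 \<le> abundancy (2 ^ l * \<Prod>S)"
      "\<And>S. S \<in> F \<Longrightarrow> abundancy (2 ^ l * \<Prod>S) \<le> 2 * B"
    and B: "B < (1 + 1 / real M) ^ Suc D"
    and x: "\<And>S. S \<in> F \<Longrightarrow> real (2 ^ l * \<Prod>S) \<le> x"
  shows "card F \<le> primitive_abundant_count x * (2 ^ l * M ^ D)"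
proof -
  define N where "N = (\<lambda>S::nat set. 2 ^ l * \<Prod>S)"
  define A where "A = {n. primitive_abundant n \<and> real n \<le> x}"
  have finA: "finite A"
    by (rule finite_subset[of _ "{..nat \<lfloor>x\<rfloor>}"]) (auto simp: A_def le_nat_iff le_floor_iff)
  have N0: "N S > 0" if "S \<in> F" for S
    using F(2)[OF that] unfolding N_def by (auto simp: prime_gt_0_nat intro!: prod_pos)
  have "\<exists>n. n dvd N S \<and> primitive_abundant n" if "S \<in> F" for S
    using primitive_abundant_divisor_exists[OF N0[OF that]] abund(1)[OF that] by (auto simp: N_def)
  then obtain f where f: "\<And>S. S \<in> F \<Longrightarrow> f S dvd N S \<and> primitive_abundant (f S)" by metis
  define g where "g = (\<lambda>S. (f S, N S div f S))"
  have g_range: "g ` F \<subseteq> A \<times> {1..2 ^ l * M ^ D}"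
  proof
    fix y assume "y \<in> g ` F"
    then obtain S where S: "S \<in> F" "y = (f S, N S div f S)" by (auto simp: g_def)
    have fS: "f S dvd N S" "primitive_abundant (f S)" "f S > 0"
      using f[OF S(1)] by (auto simp: primitive_abundant_def)
    have "real (f S) \<le> real (N S)" using fS N0[OF S(1)] by (simp add: dvd_imp_le)
    hence "f S \<in> A" using fS x[OF S(1)] by (simp add: A_def N_def)
    moreover have "N S \<le> f S * (2 ^ l * M ^ D)" unfolding N_def
    proof (rule nondeficient_divisor_cofactor_le[OF _ _ M abund(2) B])
      show "abundancy (f S) \<ge> 2" using fS nondeficient_iff[of "f S"] by (simp add: primitive_abundant_def)
    qed (use S fS F in \<open>auto simp: N_def\<close>)
    hence "N S div f S \<le> f S * (2 ^ l * M ^ D) div f S" by (rule div_le_mono)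
    hence "N S div f S \<le> 2 ^ l * M ^ D" using fS by simp
    moreover have "N S div f S \<ge> 1" using fS N0[OF S(1)] by (auto elim!: dvdE simp: Suc_le_eq)
    ultimately show "y \<in> A \<times> {1..2 ^ l * M ^ D}" using S by auto
  qed
  have "inj_on g F"
  proof (rule inj_onI)
    fix S T assume ST: "S \<in> F" "T \<in> F" "g S = g T"
    have "N S = f S * (N S div f S)" "N T = f T * (N T div f T)" using f ST by auto
    hence "N S = N T" using ST(3) unfolding g_def by (metis prod.inject)
    have sub: "X \<subseteq> Y" if "X \<in> F" "Y \<in> F" "N X = N Y" for X Y
    proof
      fix p assume p: "p \<in> X"
      have "p dvd N X" using p F(1)[OF that(1)] unfolding N_def by (intro dvd_mult dvd_prodI) auto
      thus "p \<in> Y" using that p F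
        by (intro prime_dvd_two_power_prod_primes[of Y p l]) (auto simp: N_def)
    qed
    show "S = T" using sub ST \<open>N S = N T\<close> by (metis subset_antisym)
  qed
  hence "card F \<le> card (A \<times> {1..2 ^ l * M ^ D})"
    using g_range finA by (intro card_inj_on_le[of g]) auto
  thus ?thesis by (simp add: card_cartesian_product primitive_abundant_count_def A_def)
qed

section \<open>Primes in short windows\<close>

text \<open>
  The primes in \<open>(2 ^ j, 2 ^ (j + 3)]\<close> are sorted into at most \<open>2 ^ (h + 3)\<close> intervals of length
  \<open>2 ^ (j - h)\<close>, and \<open>W\<close> is the fullest one. The factors \<open>1 + 1 / p\<close> for \<open>p\<close> in \<open>W\<close> agree with their
  lower bound \<open>y\<close> up to \<open>1 + 2 ^ -(j + h)\<close>, so a product of \<open>2 ^ h\<close> of them is known up to \<open>exp (2 ^ -j)\<close>.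
\<close>

lemma prime_window_exists:
  assumes j: "j \<ge> 9" and h: "h \<le> j"
  obtains W :: "nat set" and y :: real
  where "finite W" "\<And>p. p \<in> W \<Longrightarrow> prime p \<and> 2 ^ j < p \<and> p \<le> 2 ^ (j + 3)"
    "2 ^ j \<le> j * 2 ^ (h + 3) * card W"
    "1 + 1 / 2 ^ (j + 4) \<le> y" "y \<le> 1 + 1 / 2 ^ j"
    "\<And>p. p \<in> W \<Longrightarrow> y \<le> 1 + 1 / real p \<and> 1 + 1 / real p \<le> y * (1 + 1 / 2 ^ (j + h))"
proof -
  define P where "P = {p. prime p \<and> 2 ^ j < p \<and> p \<le> (2::nat) ^ (j + 3)}"
  define d :: nat where "d = 2 ^ (j - h)"
  define H :: nat where "H = 2 ^ (h + 3)"
  define W where "W = (\<lambda>c. {p\<in>P. p div d = c})"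
  have fin: "finite P" unfolding P_def by (rule finite_subset[of _ "{..2 ^ (j + 3)}"]) auto
  have d0: "d > 0" by (simp add: d_def)
  have d_h: "d * 2 ^ h = 2 ^ j" using h by (simp add: d_def flip: power_add)
  have dH: "d * H = 2 ^ (j + 3)" using d_h by (simp add: H_def power_add)
  have range: "2 ^ h \<le> p div d \<and> p div d \<le> H" if "p \<in> P" for p
  proof -
    have "2 ^ h * d \<le> p" "p \<le> H * d" using that d_h dH by (auto simp: P_def mult.commute)
    moreover from this(2) have "p div d \<le> H * d div d" by (rule div_le_mono)
    ultimately show ?thesis using d0 by (simp add: less_eq_div_iff_mult_less_eq)
  qed
  have "\<exists>c\<in>{1..H}. 2 ^ j \<le> j * H * card (W c)"
  proof (rule ccontr)
    assume "\<not> ?thesis"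
    hence small: "j * H * card (W c) < 2 ^ j" if "c \<in> {1..H}" for c
      using that by (meson not_le)
    have "P \<subseteq> (\<Union>c\<in>{1..H}. W c)"
    proof
      fix p assume p: "p \<in> P"
      have "1 \<le> (2::nat) ^ h" by simp
      also have "2 ^ h \<le> p div d" using range[OF p] by blast
      finally have "p div d \<in> {1..H}" using range[OF p] by simp
      thus "p \<in> (\<Union>c\<in>{1..H}. W c)" using p by (auto simp: W_def)
    qed
    hence "card P \<le> card (\<Union>c\<in>{1..H}. W c)" using fin by (intro card_mono) (auto simp: W_def)
    also have "\<dots> \<le> (\<Sum>c\<in>{1..H}. card (W c))" by (rule card_UN_le) simp
    finally have "j * H * card P \<le> (\<Sum>c\<in>{1..H}. j * H * card (W c))"
      by (simp add: sum_distrib_left[symmetric])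
    also have "\<dots> < (\<Sum>c\<in>{1..H}. 2 ^ j)"
      using small by (intro sum_strict_mono) (auto simp: H_def)
    also have "\<dots> = H * 2 ^ j" by simp
    finally have "H * (j * card P) < H * 2 ^ j" by (simp add: mult_ac)
    hence "j * card P < 2 ^ j" by simp
    thus False using many_primes_between[OF j] by (simp add: P_def)
  qed
  then obtain c where c: "c \<in> {1..H}" "2 ^ j \<le> j * H * card (W c)" by blast
  have "W c \<noteq> {}" using c(2) by (intro notI) simp
  then obtain p0 where p0: "p0 \<in> P" "p0 div d = c" by (auto simp: W_def)
  have c_range: "2 ^ h \<le> c" "c \<le> H" using range[OF p0(1)] p0(2) by auto
  define m where "m = c * d"
  have m: "2 ^ j \<le> m" "m \<le> 2 ^ (j + 3)" "m > 0"
  proof -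
    have "2 ^ h * d \<le> m" "m \<le> H * d"
      unfolding m_def using c_range by (auto intro: mult_le_mono1)
    thus "2 ^ j \<le> m" "m \<le> 2 ^ (j + 3)" by (simp_all only: mult.commute[of _ d] d_h dH)
    show "m > 0" using c d0 by (simp add: m_def)
  qed
  have d_le: "d \<le> 2 ^ j" by (simp add: d_def)
  define y where "y = 1 + 1 / real (m + d)"
  show ?thesis
  proof (rule that[of "W c" y])
    show "finite (W c)" using fin by (simp add: W_def)
    show "prime p \<and> 2 ^ j < p \<and> p \<le> 2 ^ (j + 3)" if "p \<in> W c" for p
      using that by (simp add: W_def P_def)
    show "2 ^ j \<le> j * 2 ^ (h + 3) * card (W c)" using c by (simp add: H_def)
    have "m + d \<le> 2 ^ (j + 4)" using m d_le by (simp add: power_add)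
    hence "real (m + d) \<le> 2 ^ (j + 4)" by (metis of_nat_le_iff of_nat_numeral of_nat_power)
    thus "1 + 1 / 2 ^ (j + 4) \<le> y" using m unfolding y_def by (intro add_left_mono frac_le) auto
    have rm: "2 ^ j \<le> real m" using m(1) by (metis of_nat_le_iff of_nat_numeral of_nat_power)
    hence rmd: "2 ^ j \<le> real (m + d)" unfolding of_nat_add by linarith
    thus "y \<le> 1 + 1 / 2 ^ j" unfolding y_def by (intro add_left_mono frac_le) simp_all
    fix p assume "p \<in> W c"
    hence "p div d = c" by (simp add: W_def)
    hence p: "m \<le> p" "p \<le> m + d"
      using d0 unfolding m_def by (auto simp: mult.commute times_div_less_eq_dividend
          intro: less_imp_le[OF dividend_less_times_div, THEN order_trans])
    have "1 + 1 / real p \<le> 1 + 1 / real m" using p m by (intro add_left_mono frac_le) auto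
    also have "\<dots> = y + real d / (real m * real (m + d))"
    proof -
      have "1 / a = 1 / (a + b) + b / (a * (a + b))" if "a > 0" "b \<ge> 0" for a b :: real
        using that by (simp add: field_simps add_nonneg_eq_0_iff)
      thus ?thesis using m by (simp add: y_def)
    qed
    also have "real d / (real m * real (m + d)) \<le> real d / (2 ^ j * real (m + d))"
      using rm m by (intro divide_left_mono mult_right_mono mult_pos_pos) auto
    also have "\<dots> \<le> real d / (2 ^ j * 2 ^ j)"
      using m by (intro divide_left_mono mult_left_mono mult_pos_pos rmd) auto
    also have "\<dots> = 1 / 2 ^ (j + h)"
    proof -
      have "real d * 2 ^ h = 2 ^ j" using d_h by (metis of_nat_mult of_nat_numeral of_nat_power)
      thus ?thesis by (simp add: power_add field_simps)
    qed
    also have "\<dots> \<le> y * (1 / 2 ^ (j + h))"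
      using mult_right_mono[of 1 y "1 / 2 ^ (j + h)"] by (simp add: y_def)
    finally have "1 + 1 / real p \<le> y * (1 + 1 / 2 ^ (j + h))" by (simp add: distrib_left)
    moreover have "y \<le> 1 + 1 / real p" using p m unfolding y_def by (intro add_left_mono frac_le) auto
    ultimately show "y \<le> 1 + 1 / real p \<and> 1 + 1 / real p \<le> y * (1 + 1 / 2 ^ (j + h))" by simp
  qed
qed

section \<open>Counting primitive abundant numbers\<close>

lemma exp_half_le_one_plus:
  fixes t :: real
  assumes "0 \<le> t" "t \<le> 1"
  shows "exp (t / 2) \<le> 1 + t"
proof -
  have "t * t \<le> t * 1" using assms by (intro mult_left_mono) auto
  moreover have "exp (t / 2) \<le> 1 + t / 2 + (t / 2)\<^sup>2" using assms by (intro exp_bound) auto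
  ultimately show ?thesis using assms by (simp add: power2_eq_square)
qed

text \<open>
  Replacing one factor \<open>y2\<close> by \<open>y1\<close> multiplies the product by at most \<open>y1\<close>, so the first product of \<open>k\<close> factors
  to reach \<open>A\<close> overshoots by at most \<open>y1\<close>.
\<close>

lemma least_mixture_exponent:
  fixes y1 y2 A :: real
  assumes "y2 ^ k < A" "A \<le> y1 ^ k" "1 \<le> y1" "1 \<le> y2"
  obtains i where "i \<le> k" "A \<le> y1 ^ i * y2 ^ (k - i)" "y1 ^ i * y2 ^ (k - i) \<le> A * y1"
proof -
  define Q where "Q = (\<lambda>i. A \<le> y1 ^ i * y2 ^ (k - i))"
  define i where "i = (LEAST i. Q i)"
  have Qk: "Q k" using assms by (simp add: Q_def)
  hence Qi: "Q i" and ik: "i \<le> k" unfolding i_def by (auto intro: LeastI Least_le)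
  have "i \<noteq> 0"
  proof
    assume "i = 0"
    thus False using Qi assms(1) by (simp add: Q_def)
  qed
  then obtain i' where i': "i = Suc i'" by (cases i) auto
  have "\<not> Q i'" using not_less_Least[of i' Q] i' by (simp add: i_def)
  hence "y1 ^ i' * y2 ^ (k - i') < A" by (simp add: Q_def)
  moreover have "y1 ^ i' * y2 ^ (k - i) \<le> y1 ^ i' * y2 ^ (k - i')"
    using assms i' ik by (intro mult_left_mono power_increasing) auto
  ultimately have "y1 ^ i' * y2 ^ (k - i) \<le> A" by linarith
  hence "y1 * (y1 ^ i' * y2 ^ (k - i)) \<le> y1 * A"
    using assms by (intro mult_left_mono) auto
  thus ?thesis using that[of i] ik Qi i' by (simp add: Q_def mult_ac)
qed

lemma power_le_binomial_mult_binomial: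
  fixes w :: real
  assumes "i \<le> k" "k > 0" "real k \<le> w" "w \<le> real a" "w \<le> real b"
  shows "(w / real k) ^ k \<le> real ((a choose i) * (b choose (k - i)))"
proof -
  have *: "(w / real k) ^ m \<le> real (c choose m)" if m: "m \<le> k" "w \<le> real c" for m c
  proof (cases "m = 0")
    case False
    have "w / real k \<le> real c / real m" using False m assms by (intro frac_le) auto
    hence "(w / real k) ^ m \<le> (real c / real m) ^ m" using assms by (intro power_mono) auto
    also have "\<dots> \<le> real (c choose m)" using m assms by (intro binomial_ge_n_over_k_pow_k) linarith
    finally show ?thesis .
  qed simp
  have "(w / real k) ^ k = (w / real k) ^ i * (w / real k) ^ (k - i)"
    using assms(1) by (simp flip: power_add)
  also have "\<dots> \<le> real (a choose i) * real (b choose (k - i))"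
    using assms by (intro mult_mono *) auto
  finally show ?thesis by simp
qed

lemma card_union_subsets:
  assumes "finite V" "finite W" "V \<inter> W = {}"
  shows "card {S \<union> T | S T. S \<subseteq> V \<and> card S = a \<and> T \<subseteq> W \<and> card T = b}
    = (card V choose a) * (card W choose b)"
proof -
  define X where "X = {S. S \<subseteq> V \<and> card S = a} \<times> {T. T \<subseteq> W \<and> card T = b}"
  have "{S \<union> T | S T. S \<subseteq> V \<and> card S = a \<and> T \<subseteq> W \<and> card T = b} = (\<lambda>(S, T). S \<union> T) ` X"
    by (auto simp: X_def image_iff)
  moreover have "inj_on (\<lambda>(S, T). S \<union> T) X"
  proof (rule inj_onI, clarify)
    fix S T S' T' assume "(S, T) \<in> X" "(S', T') \<in> X" and eq: "S \<union> T = S' \<union> T'"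
    hence "S \<subseteq> V" "S' \<subseteq> V" "T \<subseteq> W" "T' \<subseteq> W" by (auto simp: X_def)
    thus "S = S' \<and> T = T'" using eq assms(3) by blast
  qed
  moreover have "card X = (card V choose a) * (card W choose b)"
    unfolding X_def card_cartesian_product using assms by (simp add: n_subsets)
  ultimately show ?thesis by (simp add: card_image)
qed

text \<open>
  Take \<open>l = j + 4 - h\<close> and let \<open>A = 1 / (1 - 2 ^ -(l + 1))\<close>, so that \<open>2 ^ l * \<Prod>S\<close> is nondeficient exactly if
  \<open>\<Prod>p\<in>S. 1 + 1 / p\<close> is at least \<open>A\<close>. The product of \<open>k = 2 ^ h\<close> factors exceeds \<open>A\<close> if all primes come from a
  window near \<open>2 ^ j\<close>, and stays below \<open>A\<close> if they come from a window near \<open>2 ^ (j + 6)\<close>. Hence a suitable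
  number \<open>i\<close> of primes from the first window and \<open>k - i\<close> from the second lands in
  \<open>[A, A * exp (2 / 2 ^ j)]\<close>, whichever primes of the windows are chosen. A nondeficient divisor of such a
  number omits at most \<open>2048\<close> primes, each at most \<open>2 ^ (j + 9)\<close>; together with the power of \<open>2\<close>, this
  bounds the cofactor by \<open>2 ^ (2049 * (j + 9))\<close>.
\<close>

lemma primitive_abundant_count_ge:
  fixes x :: real and j h :: nat
  defines "k \<equiv> 2 ^ h :: nat"
  assumes j: "j \<ge> 9" and h: "h \<le> j" and room: "j * 2 ^ (2 * h + 3) \<le> 2 ^ j"
    and x: "2 ^ ((j + 9) * (k + 1)) \<le> x"
  shows "(2 ^ j / (real j * 2 ^ (2 * h + 3))) ^ k \<le> real (primitive_abundant_count x) * 2 ^ (2049 * (j + 9))"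
proof -
  obtain V y1 where V: "finite V" "\<And>p. p \<in> V \<Longrightarrow> prime p \<and> 2 ^ j < p \<and> p \<le> 2 ^ (j + 3)"
    "2 ^ j \<le> j * 2 ^ (h + 3) * card V"
    and y1: "1 + 1 / 2 ^ (j + 4) \<le> y1" "y1 \<le> 1 + 1 / 2 ^ j"
    "\<And>p. p \<in> V \<Longrightarrow> y1 \<le> 1 + 1 / real p \<and> 1 + 1 / real p \<le> y1 * (1 + 1 / 2 ^ (j + h))"
    using prime_window_exists[OF j h] by blast
  have "j + 6 \<ge> 9" "h \<le> j + 6" using j h by auto
  then obtain W y2 where W: "finite W" "\<And>p. p \<in> W \<Longrightarrow> prime p \<and> 2 ^ (j + 6) < p \<and> p \<le> 2 ^ (j + 6 + 3)"
    "2 ^ (j + 6) \<le> (j + 6) * 2 ^ (h + 3) * card W"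
    and y2: "1 + 1 / 2 ^ (j + 6 + 4) \<le> y2" "y2 \<le> 1 + 1 / 2 ^ (j + 6)"
    "\<And>p. p \<in> W \<Longrightarrow> y2 \<le> 1 + 1 / real p \<and> 1 + 1 / real p \<le> y2 * (1 + 1 / 2 ^ (j + 6 + h))"
    using prime_window_exists[of "j + 6" h] by blast
  have disj: "V \<inter> W = {}"
  proof (rule ccontr)
    assume "V \<inter> W \<noteq> {}"
    then obtain p where p: "p \<in> V" "p \<in> W" by blast
    have "p \<le> 2 ^ (j + 3)" "2 ^ (j + 6) < p" using V(2)[OF p(1)] W(2)[OF p(2)] by simp_all
    moreover have "(2::nat) ^ (j + 3) \<le> 2 ^ (j + 6)" by (intro power_increasing) auto
    ultimately show False by linarith
  qed
  define w where "w = 2 ^ j / (real j * 2 ^ (h + 3))"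
  have k0: "k > 0" "real k = 2 ^ h" by (simp_all only: k_def of_nat_power of_nat_numeral zero_less_power zero_less_numeral)
  have "2 * h + 3 = (h + 3) + h" by simp
  hence "(2::real) ^ (2 * h + 3) = 2 ^ (h + 3) * 2 ^ h" by (simp only: power_add)
  hence w_k: "w / real k = 2 ^ j / (real j * 2 ^ (2 * h + 3))" by (simp add: w_def k0)
  have "real (j * 2 ^ (2 * h + 3)) \<le> real (2 ^ j)" using room by (simp only: of_nat_le_iff)
  hence "1 \<le> w / real k" using j by (simp add: w_k)
  hence k_le_w: "real k \<le> w" using k0 by simp
  have "real (2 ^ j) \<le> real (j * 2 ^ (h + 3) * card V)" using V(3) by (simp only: of_nat_le_iff)
  hence w_V: "w \<le> real (card V)" using j by (simp add: w_def field_simps)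
  \<comment> \<open>The second window is \<open>64\<close> times further out, which outweighs its lower density.\<close>
  have "2 ^ (j + 6) \<le> (64 * j) * 2 ^ (h + 3) * card W"
    using W(3) j by (elim order_trans) (intro mult_le_mono, auto)
  hence "2 ^ j \<le> j * 2 ^ (h + 3) * card W" by (simp add: power_add mult_ac)
  hence "real (2 ^ j) \<le> real (j * 2 ^ (h + 3) * card W)" by (simp only: of_nat_le_iff)
  hence w_W: "w \<le> real (card W)" using j by (simp add: w_def field_simps)
  define l where "l = j + 4 - h"
  have l: "Suc l = j + 5 - h" "l \<le> j + 9" using h by (auto simp: l_def)
  define r where "r = (1::real) / 2 ^ Suc l"
  have "r > 0" "r \<le> 1 / 2"
    using one_le_power[of "2::real" l] by (simp_all add: r_def field_simps)
  hence r: "r > 0" "r \<le> 1 / 2" "r < 1" by simp_all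
  have r_eq: "2 ^ h / 2 ^ (j + 5) = r" using h
    unfolding r_def l(1) by (simp add: power_diff field_simps)
  define A where "A = 1 / (1 - r)"
  have A0: "A > 0" using r by (simp add: A_def)
  have abund2: "abundancy (2 ^ l) * A = 2"
    unfolding abundancy_two_power A_def r_def[symmetric] using r by (simp add: field_simps)
  have y_ge1: "y1 \<ge> 1" "y2 \<ge> 1"
    using y1(1) y2(1) by (auto intro: order_trans[rotated])
  have "A \<le> y1 ^ k"
  proof -
    have "r * r \<le> r * (1 / 2)" using r by (intro mult_left_mono) auto
    hence "A \<le> 1 + 2 * r" using r by (simp add: A_def field_simps)
    also have "2 * r = real k * (1 / 2 ^ (j + 4))" by (simp add: r_eq[symmetric] k0 power_add)
    also have "1 + real k * (1 / 2 ^ (j + 4)) \<le> (1 + 1 / 2 ^ (j + 4)) ^ k"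
      by (rule Bernoulli_inequality) (simp add: order_trans[of _ 0])
    also have "\<dots> \<le> y1 ^ k" using y1 by (intro power_mono) auto
    finally show ?thesis .
  qed
  moreover have "y2 ^ k < A"
  proof -
    have "y2 ^ k \<le> (exp (1 / 2 ^ (j + 6))) ^ k"
      using y_ge1 y2(2) by (intro power_mono) (auto intro: order_trans)
    also have "\<dots> = exp (real k * (1 / 2 ^ (j + 6)))" by (rule exp_of_nat_mult[symmetric])
    also have "real k * (1 / 2 ^ (j + 6)) = r / 2" by (simp add: r_eq[symmetric] k0 power_add)
    also have "exp (r / 2) < exp r" using r by simp
    also have "\<dots> \<le> A"
    proof -
      have "1 - r \<le> exp (- r)" using exp_ge_add_one_self[of "- r"] by simp
      thus ?thesis using r by (simp add: A_def exp_minus field_simps)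
    qed
    finally show ?thesis .
  qed
  ultimately obtain i where i: "i \<le> k" "A \<le> y1 ^ i * y2 ^ (k - i)" "y1 ^ i * y2 ^ (k - i) \<le> A * y1"
    using least_mixture_exponent[of y2 k A y1] y_ge1 by blast
  define F where "F = {S \<union> T | S T. S \<subseteq> V \<and> card S = i \<and> T \<subseteq> W \<and> card T = k - i}"
  have card_F: "card F = (card V choose i) * (card W choose (k - i))"
    unfolding F_def using V(1) W(1) disj by (rule card_union_subsets)
  define q where "q = 1 + (1::real) / 2 ^ (j + h)"
  have q0: "q \<ge> 1" by (simp add: q_def)
  have F_props: "finite U \<and> (\<forall>p\<in>U. prime p \<and> p \<noteq> 2 \<and> p \<le> 2 ^ (j + 9)) \<and> card U = k \<and>
      A \<le> (\<Prod>p\<in>U. 1 + 1 / real p) \<and> (\<Prod>p\<in>U. 1 + 1 / real p) \<le> A * exp (2 / 2 ^ j)"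
    if U: "U \<in> F" for U
  proof -
    obtain S T where ST: "U = S \<union> T" "S \<subseteq> V" "card S = i" "T \<subseteq> W" "card T = k - i"
      using U by (auto simp: F_def)
    have fin: "finite S" "finite T" using ST V(1) W(1) by (auto intro: finite_subset)
    have ST_disj: "S \<inter> T = {}" using ST disj by blast
    have big: "(2::nat) < 2 ^ j" "(2::nat) ^ (j + 3) \<le> 2 ^ (j + 9)" "(2::nat) ^ j \<le> 2 ^ (j + 6)"
      using j power_strict_increasing[of 1 j "2::nat"] by (auto intro: power_increasing)
    have U_primes: "prime p \<and> p \<noteq> 2 \<and> p \<le> 2 ^ (j + 9)" if "p \<in> U" for p
    proof (cases "p \<in> S")
      case True
      hence "prime p \<and> 2 ^ j < p \<and> p \<le> 2 ^ (j + 3)" using V(2) ST by blast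
      thus ?thesis using big by linarith
    next
      case False
      hence "p \<in> W" using that ST by blast
      hence "prime p \<and> 2 ^ (j + 6) < p \<and> p \<le> 2 ^ (j + 6 + 3)" by (rule W(2))
      moreover have "j + 6 + 3 = j + 9" by simp
      ultimately show ?thesis using big by (metis less_le_trans less_trans nat_neq_iff)
    qed
    have card_U: "card U = k" using ST fin ST_disj i by (simp add: card_Un_disjoint)
    have prod_U: "(\<Prod>p\<in>U. 1 + 1 / real p) = (\<Prod>p\<in>S. 1 + 1 / real p) * (\<Prod>p\<in>T. 1 + 1 / real p)"
      using ST(1) fin ST_disj by (simp add: prod.union_disjoint)
    have S_ge: "y1 ^ i \<le> (\<Prod>p\<in>S. 1 + 1 / real p)"
    proof -
      have "(\<Prod>p\<in>S. y1) \<le> (\<Prod>p\<in>S. 1 + 1 / real p)"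
        using y1(3) ST(2) y_ge1 by (intro prod_mono) force
      thus ?thesis using ST by simp
    qed
    have T_ge: "y2 ^ (k - i) \<le> (\<Prod>p\<in>T. 1 + 1 / real p)"
    proof -
      have "(\<Prod>p\<in>T. y2) \<le> (\<Prod>p\<in>T. 1 + 1 / real p)"
        using y2(3) ST(4) y_ge1 by (intro prod_mono) force
      thus ?thesis using ST by simp
    qed
    have S_le: "(\<Prod>p\<in>S. 1 + 1 / real p) \<le> (y1 * q) ^ i"
    proof -
      have "(\<Prod>p\<in>S. 1 + 1 / real p) \<le> (\<Prod>p\<in>S. y1 * q)"
        using y1(3) ST(2) by (intro prod_mono) (auto simp: q_def)
      thus ?thesis using ST by simp
    qed
    have T_le: "(\<Prod>p\<in>T. 1 + 1 / real p) \<le> (y2 * q) ^ (k - i)"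
    proof -
      have "(1::real) / 2 ^ (j + 6 + h) \<le> 1 / 2 ^ (j + h)"
        by (intro divide_left_mono power_increasing) auto
      hence "y2 * (1 + 1 / 2 ^ (j + 6 + h)) \<le> y2 * q"
        using y_ge1 by (intro mult_left_mono) (auto simp: q_def)
      hence "(\<Prod>p\<in>T. 1 + 1 / real p) \<le> (\<Prod>p\<in>T. y2 * q)"
        using y2(3) ST(4) by (intro prod_mono) (auto intro: order_trans)
      thus ?thesis using ST by simp
    qed
    have "A \<le> y1 ^ i * y2 ^ (k - i)" by (rule i)
    also have "\<dots> \<le> (\<Prod>p\<in>U. 1 + 1 / real p)"
      unfolding prod_U using S_ge T_ge y_ge1 by (intro mult_mono) (auto intro: order_trans[of 0 "y1 ^ i"])
    finally have 1: "A \<le> (\<Prod>p\<in>U. 1 + 1 / real p)" .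
    have "(\<Prod>p\<in>U. 1 + 1 / real p) \<le> (y1 * q) ^ i * (y2 * q) ^ (k - i)"
      unfolding prod_U using S_le T_le y_ge1 q0 by (intro mult_mono) (auto intro: prod_nonneg)
    also have "\<dots> = (y1 ^ i * y2 ^ (k - i)) * q ^ k"
      using i(1) by (simp add: power_mult_distrib mult_ac flip: power_add)
    also have "\<dots> \<le> (A * y1) * q ^ k" using i(3) q0 by (intro mult_right_mono) auto
    also have "\<dots> \<le> (A * exp (1 / 2 ^ j)) * exp (1 / 2 ^ j)"
    proof (intro mult_mono)
      show "y1 \<le> exp (1 / 2 ^ j)" using y1(2) exp_ge_add_one_self by (rule order_trans)
      have "q ^ k \<le> exp (1 / 2 ^ (j + h)) ^ k" using q0 unfolding q_def by (intro power_mono) auto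
      also have "\<dots> = exp (real k * (1 / 2 ^ (j + h)))" by (rule exp_of_nat_mult[symmetric])
      also have "real k * (1 / 2 ^ (j + h)) = 1 / 2 ^ j" by (simp add: k0 power_add)
      finally show "q ^ k \<le> exp (1 / 2 ^ j)" .
    qed (use A0 q0 y_ge1 in auto)
    also have "\<dots> = A * exp (2 / 2 ^ j)" by (simp flip: exp_add)
    finally have 2: "(\<Prod>p\<in>U. 1 + 1 / real p) \<le> A * exp (2 / 2 ^ j)" .
    have "finite U" using fin ST(1) by simp
    thus ?thesis using U_primes card_U 1 2 by blast
  qed
  have abund: "abundancy (2 ^ l * \<Prod>U) = abundancy (2 ^ l) * (\<Prod>p\<in>U. 1 + 1 / real p)" if "U \<in> F" for U
    using F_props[OF that] by (intro abundancy_two_power_prod_primes) auto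
  have abund0: "abundancy (2 ^ l) > 0"
    unfolding abundancy_two_power r_def[symmetric] using r by simp
  have "card F \<le> primitive_abundant_count x * (2 ^ l * (2 ^ (j + 9)) ^ 2048)"
  proof (rule card_family_le_primitive_abundant_count[where B = "exp (2 / 2 ^ j)"])
    show "exp (2 / 2 ^ j) < (1 + 1 / real (2 ^ (j + 9))) ^ Suc 2048"
    proof -
      define t where "t = 1 / (2::real) ^ (j + 9)"
      have t: "0 < t" "t \<le> 1" by (simp_all add: t_def)
      \<comment> \<open>The choice of \<open>D = 2048\<close>: the exponent \<open>2 / 2 ^ j\<close> is \<open>2048\<close> times \<open>t / 2\<close>, and \<open>exp (t / 2) \<le> 1 + t\<close>.\<close>
      have "2 / 2 ^ j = 2048 * (t / 2)" by (simp add: t_def power_add)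
      hence "exp (2 / 2 ^ j) < exp (real (Suc 2048) * (t / 2))" using t by simp
      also have "\<dots> = exp (t / 2) ^ Suc 2048" by (rule exp_of_nat_mult)
      also have "\<dots> \<le> (1 + t) ^ Suc 2048" using t by (intro power_mono exp_half_le_one_plus) auto
      finally show ?thesis by (simp only: t_def of_nat_power of_nat_numeral)
    qed
    fix U assume U: "U \<in> F"
    show "finite U" using F_props[OF U] by blast
    show "prime p \<and> p \<noteq> 2 \<and> p \<le> 2 ^ (j + 9)" if "p \<in> U" for p using F_props[OF U] that by blast
    show "2 \<le> abundancy (2 ^ l * \<Prod>U)"
      using mult_left_mono[of A "\<Prod>p\<in>U. 1 + 1 / real p" "abundancy (2 ^ l)"] F_props[OF U] abund0
      by (simp add: abund[OF U] abund2)
    show "abundancy (2 ^ l * \<Prod>U) \<le> 2 * exp (2 / 2 ^ j)"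
      using mult_left_mono[of "\<Prod>p\<in>U. 1 + 1 / real p" "A * exp (2 / 2 ^ j)" "abundancy (2 ^ l)"]
        F_props[OF U] abund0
      by (simp add: abund[OF U] abund2 flip: mult.assoc)
    have "\<Prod>U \<le> (\<Prod>p\<in>U. 2 ^ (j + 9))" using F_props[OF U] by (intro prod_mono) auto
    also have "\<dots> = 2 ^ ((j + 9) * k)" using F_props[OF U] by (simp add: power_mult)
    finally have "2 ^ l * \<Prod>U \<le> 2 ^ (j + 9) * 2 ^ ((j + 9) * k)"
      using l(2) by (intro mult_le_mono power_increasing) auto
    also have "\<dots> = 2 ^ ((j + 9) * (k + 1))" by (simp add: distrib_left add.commute flip: power_add)
    finally have "real (2 ^ l * \<Prod>U) \<le> real (2 ^ ((j + 9) * (k + 1)))" by (simp only: of_nat_le_iff)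
    also have "\<dots> \<le> x" using x by simp
    finally show "real (2 ^ l * \<Prod>U) \<le> x" .
  qed simp
  also have "(2::nat) ^ l * (2 ^ (j + 9)) ^ 2048 \<le> 2 ^ (j + 9) * (2 ^ (j + 9)) ^ 2048"
    using l(2) by (intro mult_le_mono1 power_increasing) auto
  also have "\<dots> = ((2::nat) ^ (j + 9)) ^ Suc 2048" by (rule power_Suc[symmetric])
  also have "\<dots> = 2 ^ (2049 * (j + 9))" by (simp only: power_mult[symmetric] mult.commute) simp
  finally have "card F \<le> primitive_abundant_count x * 2 ^ (2049 * (j + 9))" by simp
  hence "real (card F) \<le> real (primitive_abundant_count x * 2 ^ (2049 * (j + 9)))"
    by (simp only: of_nat_le_iff)
  moreover have "(w / real k) ^ k \<le> real (card F)"
    unfolding card_F using i(1) k0(1) k_le_w w_V w_W by (rule power_le_binomial_mult_binomial)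
  ultimately show ?thesis by (simp add: w_k)
qed

text \<open>
  Let \<open>k = 2 ^ h\<close> be the largest power of \<open>2\<close> up to \<open>sqrt L / C\<close>, and choose \<open>j\<close> as large as
  \<open>2 ^ ((j + 9) * (k + 1)) \<le> x\<close> permits, so that \<open>j * k * ln 2\<close> is \<open>L\<close> up to \<open>O(j + k)\<close>. Each of the \<open>k\<close>
  primes loses a factor of about \<open>j * k\<^sup>2 = O(L\<^sup>2)\<close>, in total \<open>exp (2 / C * sqrt L * ln L)\<close>, and the cofactor
  loses \<open>2 ^ O(j) = exp (O(C * sqrt L))\<close>, which is of lower order for every fixed \<open>C\<close>. So \<open>C = 4 / \<epsilon>\<close>
  suffices.
\<close>

lemma primitive_abundant_count_asymp:
  fixes \<epsilon> :: real
  assumes eps: "\<epsilon> > 0"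
  shows "\<forall>\<^sub>F x in at_top. x * exp (- (\<epsilon> * (sqrt (ln x) * ln (ln x)))) \<le> real (primitive_abundant_count x)"
proof -
  define C where "C = max 1 (4 / \<epsilon>)"
  have C: "C \<ge> 1" "C \<ge> 4 / \<epsilon>" by (simp_all add: C_def)
  have C0: "C > 0" using C by linarith
  have ln2: "1 / 2 \<le> ln (2::real)" "ln (2::real) \<le> 1"
    using ln_le_minus_one[of "1 / 2 :: real"] ln_le_minus_one[of "2 :: real"] by (simp_all add: ln_div)
  have ev_1: "\<forall>\<^sub>F L in at_top. sqrt L \<ge> C" by real_asymp
  have ev_2: "\<forall>\<^sub>F L::real in at_top. sqrt L / 2 - 1 \<ge> 18" by real_asymp
  have ev_3: "\<forall>\<^sub>F L::real in at_top. 8 * L * L \<le> 2 powr (sqrt L / 2 - 10)" by real_asymp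
  have ev_4: "\<forall>\<^sub>F L in at_top. 8200 * C * sqrt L + 13 * sqrt L + 18451 \<le> \<epsilon> / 2 * (sqrt L * ln L)"
    using eps C0 by real_asymp
  have "filterlim (ln :: real \<Rightarrow> real) at_top at_top" by (rule ln_at_top)
  hence lift: "\<forall>\<^sub>F x in at_top. P (ln x)" if "eventually P at_top" for P :: "real \<Rightarrow> bool"
    using that by (auto simp: filterlim_iff)
  show ?thesis
    using lift[OF ev_1] lift[OF ev_2] lift[OF ev_3] lift[OF ev_4] eventually_gt_at_top[of 0]
      lift[OF eventually_ge_at_top[of 1]]
  proof eventually_elim
    case (elim x)
    define L where "L = ln x"
    have L: "L \<ge> 1" "x = exp L" using elim(5,6) by (simp_all add: L_def)
    have sL: "sqrt L \<ge> 1" "sqrt L * sqrt L = L" "sqrt L \<ge> C" using L(1) elim(1) by (simp_all add: L_def)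
    define h where "h = nat \<lfloor>log 2 (sqrt L / C)\<rfloor>"
    define k :: nat where "k = 2 ^ h"
    have "0 \<le> log 2 (sqrt L / C)" using sL C0 by (simp add: zero_le_log_cancel_iff)
    hence h: "real h \<le> log 2 (sqrt L / C)" "log 2 (sqrt L / C) < real h + 1"
      unfolding h_def by linarith+
    have k_eq: "real k = 2 powr real h" by (simp add: k_def powr_realpow)
    have k_le: "real k \<le> sqrt L / C"
      using h(1) sL C0 by (simp add: k_eq le_log_iff)
    have k_gt: "sqrt L / C < 2 * real k"
      using h(2) sL C0 by (simp add: k_eq log_less_iff powr_add)
    have k1: "real k \<ge> 1" by (simp add: k_def)
    have "sqrt L / C \<le> sqrt L" using C sL by (simp add: field_simps mult_left_le)
    hence k_sL: "real k \<le> sqrt L" using k_le by linarith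
    have k_sq: "real k * real k \<le> L" using k_sL k1 sL mult_mono[of "real k" "sqrt L" "real k" "sqrt L"] by simp
    define m where "m = nat \<lfloor>L / (ln 2 * (real k + 1))\<rfloor>"
    have den: "ln 2 * (real k + 1) > 0" using ln2 k1 by (intro mult_pos_pos) auto
    have den_le: "ln 2 * (real k + 1) \<le> 2 * sqrt L"
    proof -
      have "ln 2 * (real k + 1) \<le> 1 * (real k + 1)" using ln2 k1 by (intro mult_right_mono) auto
      also have "\<dots> \<le> 2 * sqrt L" using add_mono[OF k_sL sL(1)] by (simp only: mult_1 mult_2)
      finally show ?thesis .
    qed
    have "sqrt L / 2 = L / (2 * sqrt L)" using sL by (simp add: field_simps)
    also have "\<dots> \<le> L / (ln 2 * (real k + 1))" using den_le den L sL by (intro divide_left_mono) auto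
    finally have "sqrt L / 2 \<le> L / (ln 2 * (real k + 1))" .
    moreover have "0 \<le> L / (ln 2 * (real k + 1))" using den L by simp
    ultimately have m: "real m \<le> L / (ln 2 * (real k + 1))" "L / (ln 2 * (real k + 1)) < real m + 1"
        "sqrt L / 2 - 1 \<le> real m"
      unfolding m_def by linarith+
    define j where "j = m - 9"
    have m18: "real m \<ge> 18" using m(3) elim(2) unfolding L_def by linarith
    hence mj: "m = j + 9" "j \<ge> 9" by (auto simp: j_def)
    have upper: "real (j + 9) * (real k + 1) * ln 2 \<le> L"
      using m(1) den by (simp add: mj(1)[symmetric] pos_le_divide_eq mult_ac)
    have lower: "L \<le> real (j + 10) * (real k + 1) * ln 2"
      using m(2) den by (simp add: mj pos_divide_less_eq mult_ac add_ac)
    have j_le: "real j * ((real k + 1) * ln 2) \<le> L"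
    proof -
      have "real j * ((real k + 1) * ln 2) \<le> real (j + 9) * ((real k + 1) * ln 2)"
        using den by (intro mult_right_mono) (auto simp: mult_ac)
      also have "\<dots> \<le> L" using upper by (simp only: mult.assoc)
      finally show ?thesis .
    qed
    have "1 \<le> 2 * ln (2::real)" using ln2 by simp
    also have "\<dots> \<le> (real k + 1) * ln 2" using ln2 k1 by (intro mult_right_mono) auto
    finally have "real j * 1 \<le> real j * ((real k + 1) * ln 2)" by (intro mult_left_mono) auto
    hence j_L: "real j \<le> L" using j_le by linarith
    have j_sL: "real j \<le> 4 * C * sqrt L"
    proof -
      have "sqrt L / (2 * C) * (1 / 2) \<le> (real k + 1) * ln 2"
        using k_gt ln2 C0 sL by (intro mult_mono) (auto simp: field_simps)
      hence "real j * (sqrt L / (2 * C) * (1 / 2)) \<le> L"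
        using j_le by (meson mult_left_mono of_nat_0_le_iff order_trans)
      hence "real j * sqrt L \<le> 4 * C * L" using C0 by (simp add: field_simps)
      also have "\<dots> = (4 * C * sqrt L) * sqrt L" by (simp only: sL(2) mult.assoc)
      finally show ?thesis by (rule mult_right_le_imp_le) (use L in simp)
    qed
    have pow2: "(2::real) ^ (2 * h) = real k * real k" by (simp add: k_def mult_2 power_add)
    have room: "j * 2 ^ (2 * h + 3) \<le> 2 ^ j"
    proof -
      have "real (j * 2 ^ (2 * h + 3)) = 8 * real j * (real k * real k)"
        by (simp add: pow2[symmetric] power_add)
      also have "\<dots> \<le> 8 * L * L" using j_L k_sq by (intro mult_mono) auto
      also have "\<dots> \<le> 2 powr (sqrt L / 2 - 10)" using elim(3) by (simp only: L_def)
      also have "\<dots> \<le> 2 powr real j" using m(3) mj by (intro powr_mono) auto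
      also have "\<dots> = real (2 ^ j)" by (simp add: powr_realpow)
      finally show ?thesis by (simp only: of_nat_le_iff)
    qed
    have "2 ^ h \<le> j * 2 ^ (2 * h + 3)"
      using mj mult_le_mono[of 1 j "2 ^ h" "2 ^ (2 * h + 3) :: nat"] power_increasing[of h "2 * h + 3" "2::nat"]
      by simp
    hence "(2::nat) ^ h \<le> 2 ^ j" using room by (rule order_trans)
    hence hj: "h \<le> j" by (subst (asm) power_increasing_iff) auto
    have x_ge: "2 ^ ((j + 9) * (2 ^ h + 1)) \<le> x"
    proof -
      have "(2::real) ^ ((j + 9) * (2 ^ h + 1)) = exp (real ((j + 9) * (k + 1)) * ln 2)"
        unfolding exp_of_nat_mult by (simp add: k_def)
      also have "\<dots> \<le> exp L" using upper by (simp add: algebra_simps)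
      finally show ?thesis using L by simp
    qed
    define Z where "Z = 2 ^ j / (real j * 2 ^ (2 * h + 3))"
    have j0: "real j > 0" using mj by simp
    have Z0: "Z > 0" using j0 by (simp add: Z_def)
    have "ln Z = real j * ln 2 - (ln (real j) + (2 * real h + 3) * ln 2)"
      using j0 by (simp add: Z_def ln_div ln_mult ln_realpow)
    moreover have "ln (real j) \<le> ln L" using j0 j_L by (subst ln_le_cancel_iff) auto
    moreover have "2 * real h * ln 2 \<le> ln L"
    proof -
      have "(2::real) ^ (2 * h) \<le> L" using pow2 k_sq by simp
      hence "ln ((2::real) ^ (2 * h)) \<le> ln L" using L(1) by (subst ln_le_cancel_iff) simp_all
      thus ?thesis by (simp add: ln_realpow)
    qed
    ultimately have lnZ: "real j * ln 2 - 2 * ln L - 3 \<le> ln Z"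
      using ln2 by (simp add: algebra_simps)
    have "real k * (real j * ln 2 - 2 * ln L - 3) \<le> real k * ln Z"
      using lnZ by (intro mult_left_mono) auto
    hence "real k * (real j * ln 2) - real k * (2 * ln L) - 3 * real k \<le> real k * ln Z"
      by (simp add: right_diff_distrib)
    moreover have "real (j + 10) * (real k + 1) * ln 2
        = real k * (real j * ln 2) + (real j + 10 * real k + 10) * ln 2"
      by (simp add: algebra_simps)
    moreover have "(real j + 10 * real k + 10) * ln 2 \<le> real j + 10 * real k + 10"
      using ln2 by (intro mult_left_le) auto
    moreover have "real (2049 * (j + 9)) * ln 2 \<le> real (2049 * (j + 9))"
      using ln2 by (intro mult_left_le) auto
    moreover have "real (2049 * (j + 9)) = 2049 * real j + 18441" by simp
    moreover have "real k * (2 * ln L) \<le> \<epsilon> / 2 * (sqrt L * ln L)"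
    proof -
      have "1 / C \<le> \<epsilon> / 4" using C eps C0 by (simp add: field_simps)
      hence "sqrt L * (1 / C) \<le> sqrt L * (\<epsilon> / 4)" using sL by (intro mult_left_mono) auto
      moreover have "real k \<le> sqrt L * (1 / C)" using k_le by simp
      ultimately have "real k \<le> sqrt L * (\<epsilon> / 4)" by (rule order_trans[rotated])
      hence "real k * (2 * ln L) \<le> sqrt L * (\<epsilon> / 4) * (2 * ln L)"
        using L by (intro mult_right_mono) auto
      thus ?thesis by (simp add: mult_ac)
    qed
    moreover have "8200 * C * sqrt L + 13 * sqrt L + 18451 \<le> \<epsilon> / 2 * (sqrt L * ln L)"
      using elim(4) by (simp only: L_def)
    ultimately have "L - \<epsilon> * (sqrt L * ln L) \<le> real k * ln Z - real (2049 * (j + 9)) * ln 2"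
      using lower j_sL k_sL by linarith
    hence "exp (L - \<epsilon> * (sqrt L * ln L)) \<le> exp (real k * ln Z - real (2049 * (j + 9)) * ln 2)" by simp
    also have "\<dots> = exp (ln Z) ^ k / exp (ln 2) ^ (2049 * (j + 9))"
      by (simp only: exp_diff exp_of_nat_mult)
    also have "\<dots> = Z ^ k / 2 ^ (2049 * (j + 9))" using Z0 by simp
    also have "\<dots> \<le> real (primitive_abundant_count x)"
      using primitive_abundant_count_ge[OF mj(2) hj room x_ge]
      by (simp add: Z_def k_def pos_divide_le_eq)
    finally show ?case using L by (simp add: exp_diff exp_minus field_simps)
  qed
qed

section \<open>Comparison of the two counts\<close>

theorem corollary2p4:
  shows "filterlim (\<lambda>x::real. real (primitive_abundant_count x) / real (primitive_covering_count x))
           at_top at_top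
         \<and> (\<forall>\<epsilon>::real. \<epsilon> > 0 \<longrightarrow>
              (\<forall>\<^sub>F x::real in at_top.
                 real (primitive_abundant_count x) / real (primitive_covering_count x)
                 > exp ((1 / (2 * sqrt (ln 2)) - \<epsilon>) * sqrt (ln x) * ln (ln x))))"
proof -
  define c where "c = 1 / (2 * sqrt (ln (2::real)))"
  define G where "G = (\<lambda>x::real. sqrt (ln x) * ln (ln x))"
  have c0: "c > 0" by (simp add: c_def)
  have ev_G: "\<forall>\<^sub>F x in at_top. G x > 0" unfolding G_def by real_asymp
  have main: "\<forall>\<^sub>F x in at_top. real (primitive_abundant_count x) / real (primitive_covering_count x)
      > exp ((c - \<epsilon>) * G x)" if eps: "\<epsilon> > 0" for \<epsilon> :: real
  proof -
    have e: "\<epsilon> / 3 > 0" using eps by simp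
    show ?thesis
      using primitive_abundant_count_asymp[OF e] primitive_covering_count_asymp[OF e] ev_G
        eventually_ge_at_top[of 12]
    proof eventually_elim
      case (elim x)
      have pos: "real (primitive_covering_count x) > 0"
        using primitive_covering_count_pos[of x] elim by simp
      have upper: "real (primitive_covering_count x) \<le> x * exp (- ((c - \<epsilon> / 3) * G x))"
        and lower: "x * exp (- (\<epsilon> / 3 * G x)) \<le> real (primitive_abundant_count x)"
        using elim by (simp_all add: c_def G_def)
      have "(c - \<epsilon>) * G x < (c - 2 * \<epsilon> / 3) * G x" using elim eps by (intro mult_strict_right_mono) auto
      hence "exp ((c - \<epsilon>) * G x) < exp (- (\<epsilon> / 3 * G x) - - ((c - \<epsilon> / 3) * G x))"
        by (simp add: algebra_simps)
      also have "\<dots> = x * exp (- (\<epsilon> / 3 * G x)) / (x * exp (- ((c - \<epsilon> / 3) * G x)))"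
        using elim by (subst exp_diff) simp
      also have "\<dots> \<le> real (primitive_abundant_count x) / real (primitive_covering_count x)"
        using upper lower pos elim by (intro frac_le) auto
      finally show ?case .
    qed
  qed
  \<comment> \<open>The divergence is the quantitative bound for \<open>\<epsilon> = c / 2\<close>.\<close>
  have "filterlim (\<lambda>x. exp ((c - c / 2) * G x)) at_top at_top"
  proof -
    have "filterlim G at_top at_top" unfolding G_def by real_asymp
    hence "filterlim (\<lambda>x. (c - c / 2) * G x) at_top at_top"
      using c0 by (intro filterlim_tendsto_pos_mult_at_top[OF tendsto_const]) auto
    thus ?thesis by (rule filterlim_compose[OF exp_at_top])
  qed
  moreover have "\<forall>\<^sub>F x in at_top. exp ((c - c / 2) * G x)
      \<le> real (primitive_abundant_count x) / real (primitive_covering_count x)"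
    using main[of "c / 2"] c0 by (auto elim: eventually_mono)
  ultimately have "filterlim (\<lambda>x. real (primitive_abundant_count x) / real (primitive_covering_count x))
      at_top at_top"
    by (rule filterlim_at_top_mono)
  thus ?thesis using main by (simp add: c_def G_def mult.assoc)
qed

end
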